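(* Let $0\le\alpha<1$. Every nonzero Schwartz function $\psi\in\mathcal{S}(\mathbb{R})$ is admissible for the $\alpha$-modulation transform. In particular, there exist compactly supported functions $\psi\in L^2(\mathbb{R})\setminus\{0\}$ that are admissible for the $\alpha$-modulation transform.
   Context: Fourier transform: $\hat f(\xi)=\int_{\mathbb{R}} f(x)e^{-2\pi i \xi x}\,dx$. For $x,\omega\in\mathbb{R}$ and $a>0$ define the unitary operators on $L^2(\mathbb{R})$: $T_xf(t)=f(t-x)$, $M_\omega f(t)=e^{2\pi i\omega t}f(t)$, $D_af(t)=a^{-1/2}f(t/a)$. Let $\beta(\omega)=(1+|\omega|)^{-\alpha}$ and $\pi(\sigma(x,\omega))=T_xM_\omega D_{\beta(\omega)}$. For $\psi\in L^2(\mathbb{R})\setminus\{0\}$ define weakly $A_\sigma f=\int_{\mathbb{R}}\int_{\mathbb{R}}\langle f,\pi(\sigma(x,\omega))\psi\rangle\,\pi(\sigma(x,\omega))\psi\,dx\,d\omega$. The vector $\psi$ is called admissible (for the $\alpha$-modulation transform) if $A_\sigma$ is bounded and boundedly invertible on $L^2(\mathbb{R})$. It is known that $A_\sigma$ is the Fourier multiplier $\widehat{A_\sigma f}=m_\psi\hat f$ with $m_\psi(\xi)=\int_{\mathbb{R}}|\hat\psi(\beta(\omega)(\xi-\omega))|^2\beta(\omega)\,d\omega$, so that admissibility is equivalent to the existence of constants $A,B$ with $0<A\le m_\psi(\xi)\le B<\infty$ for almost all $\xi\in\mathbb{R}$. *)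

theory Defs
  imports "HOL-Analysis.Analysis"
begin

text \<open>
  The Hilbert space \<open>L\<^sup>2(\<real>)\<close> is represented by Borel measurable square-integrable functions.
  Its elements proper are the classes of such functions modulo equality almost everywhere, so
  equations between elements of \<open>L\<^sup>2(\<real>)\<close> are stated with \<open>AE\<close>. Every class of Lebesgue
  measurable functions has a Borel measurable representative.
\<close>

definition L2 :: "(real \<Rightarrow> complex) set" where
  "L2 = {f. f \<in> borel_measurable lborel \<and> integrable lborel (\<lambda>t. (cmod (f t))\<^sup>2)}"

definition L2_inner :: "(real \<Rightarrow> complex) \<Rightarrow> (real \<Rightarrow> complex) \<Rightarrow> complex" where
  "L2_inner f g = (LINT t|lborel. f t * cnj (g t))"

definition L2_norm :: "(real \<Rightarrow> complex) \<Rightarrow> real" where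
  "L2_norm f = sqrt (LINT t|lborel. (cmod (f t))\<^sup>2)"

definition L2_eq :: "(real \<Rightarrow> complex) \<Rightarrow> (real \<Rightarrow> complex) \<Rightarrow> bool" where
  "L2_eq f g \<longleftrightarrow> (AE t in lborel. f t = g t)"

definition L2_bounded_operator :: "((real \<Rightarrow> complex) \<Rightarrow> (real \<Rightarrow> complex)) \<Rightarrow> bool" where
  "L2_bounded_operator T \<longleftrightarrow>
     (\<forall>f\<in>L2. T f \<in> L2) \<and>
     (\<forall>f\<in>L2. \<forall>g\<in>L2. L2_eq f g \<longrightarrow> L2_eq (T f) (T g)) \<and>
     (\<forall>f\<in>L2. \<forall>g\<in>L2. L2_eq (T (\<lambda>t. f t + g t)) (\<lambda>t. T f t + T g t)) \<and>
     (\<forall>c. \<forall>f\<in>L2. L2_eq (T (\<lambda>t. c * f t)) (\<lambda>t. c * T f t)) \<and>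
     (\<exists>C. \<forall>f\<in>L2. L2_norm (T f) \<le> C * L2_norm f)"

definition L2_boundedly_invertible :: "((real \<Rightarrow> complex) \<Rightarrow> (real \<Rightarrow> complex)) \<Rightarrow> bool" where
  "L2_boundedly_invertible T \<longleftrightarrow>
     (\<exists>S. L2_bounded_operator S \<and> (\<forall>f\<in>L2. L2_eq (S (T f)) f \<and> L2_eq (T (S f)) f))"

definition translation :: "real \<Rightarrow> (real \<Rightarrow> complex) \<Rightarrow> (real \<Rightarrow> complex)" where
  "translation x f = (\<lambda>t. f (t - x))"

definition modulation :: "real \<Rightarrow> (real \<Rightarrow> complex) \<Rightarrow> (real \<Rightarrow> complex)" where
  "modulation \<omega> f = (\<lambda>t. exp (2 * of_real pi * \<i> * of_real \<omega> * of_real t) * f t)"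

definition dilation :: "real \<Rightarrow> (real \<Rightarrow> complex) \<Rightarrow> (real \<Rightarrow> complex)" where
  "dilation a f = (\<lambda>t. of_real (a powr (- 1 / 2)) * f (t / a))"

definition alpha_scale :: "real \<Rightarrow> real \<Rightarrow> real" where
  "alpha_scale \<alpha> \<omega> = (1 + \<bar>\<omega>\<bar>) powr (- \<alpha>)"

definition alpha_atom :: "real \<Rightarrow> (real \<Rightarrow> complex) \<Rightarrow> real \<Rightarrow> real \<Rightarrow> (real \<Rightarrow> complex)" where
  "alpha_atom \<alpha> \<psi> x \<omega> = translation x (modulation \<omega> (dilation (alpha_scale \<alpha> \<omega>) \<psi>))"

text \<open>
  \<open>T\<close> is the operator \<open>A\<^sub>\<sigma>\<close>, whose defining double integral is read weakly: it is tested
  against every \<open>g \<in> L\<^sup>2(\<real>)\<close>. The explicit integrability condition is needed because the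
  Bochner integral of a non-integrable function is \<open>0\<close> by convention.
\<close>

definition is_weak_alpha_operator ::
    "real \<Rightarrow> (real \<Rightarrow> complex) \<Rightarrow> ((real \<Rightarrow> complex) \<Rightarrow> (real \<Rightarrow> complex)) \<Rightarrow> bool" where
  "is_weak_alpha_operator \<alpha> \<psi> T \<longleftrightarrow>
     (\<forall>f\<in>L2. \<forall>g\<in>L2.
        integrable (lborel \<Otimes>\<^sub>M lborel)
          (\<lambda>(x, \<omega>). L2_inner f (alpha_atom \<alpha> \<psi> x \<omega>) * L2_inner (alpha_atom \<alpha> \<psi> x \<omega>) g) \<and>
        L2_inner (T f) g =
          (LINT (x, \<omega>)|(lborel \<Otimes>\<^sub>M lborel).
             L2_inner f (alpha_atom \<alpha> \<psi> x \<omega>) * L2_inner (alpha_atom \<alpha> \<psi> x \<omega>) g))"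

definition alpha_admissible :: "real \<Rightarrow> (real \<Rightarrow> complex) \<Rightarrow> bool" where
  "alpha_admissible \<alpha> \<psi> \<longleftrightarrow>
     \<psi> \<in> L2 \<and> \<not> L2_eq \<psi> (\<lambda>_. 0) \<and>
     (\<exists>T. L2_bounded_operator T \<and> is_weak_alpha_operator \<alpha> \<psi> T \<and> L2_boundedly_invertible T)"

definition iterated_derivative :: "nat \<Rightarrow> (real \<Rightarrow> complex) \<Rightarrow> (real \<Rightarrow> complex)" where
  "iterated_derivative n f = ((\<lambda>h x. vector_derivative h (at x)) ^^ n) f"

definition schwartz :: "(real \<Rightarrow> complex) \<Rightarrow> bool" where
  "schwartz f \<longleftrightarrow>
     (\<forall>n x. iterated_derivative n f differentiable (at x)) \<and>
     (\<forall>k n. bounded (range (\<lambda>x. of_real (x ^ k) * iterated_derivative n f x)))"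

end

theory Submission
  imports Defs
    "HOL-Probability.Characteristic_Functions"
    "HOL-Probability.Sinc_Integral"
    "HOL-Computational_Algebra.Polynomial"
    "HOL-Real_Asymp.Real_Asymp"
begin

text \<open>
  Write \<open>F\<close> for the Fourier transform. For fixed \<open>\<omega>\<close> the function \<open>x \<mapsto> \<langle>f, \<pi>(\<sigma>(x, \<omega>))\<psi>\<rangle>\<close> is a
  convolution of \<open>f\<close>, so for continuous, bounded, integrable \<open>f\<close> Plancherel's identity yields
  \<open>\<integral>\<integral> |\<langle>f, \<pi>(\<sigma>(x, \<omega>))\<psi>\<rangle>|\<^sup>2 dx d\<omega> = \<integral> |F f|\<^sup>2 m\<^sub>\<psi>\<close>. Bounds \<open>A \<le> m\<^sub>\<psi> \<le> B\<close> therefore make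
  \<open>(f, g) \<mapsto> \<integral>\<integral> \<langle>f, \<pi>\<psi>\<rangle> \<langle>\<pi>\<psi>, g\<rangle>\<close> a bounded coercive hermitian form, first for such \<open>f\<close> and then by
  density (Fatou) on all of \<open>L\<^sup>2\<close>. No Fourier transform on \<open>L\<^sup>2\<close> is needed: representing this form by
  the inner product gives \<open>A\<^sub>\<sigma>\<close>, and representing the inner product by this form gives its inverse.

  The upper bound for \<open>m\<^sub>\<psi>\<close> needs only \<open>(1 + |\<xi>|) ^ n |F \<psi> (\<xi>)| \<le> C\<close> with \<open>n (1 - \<alpha>) \<ge> 1\<close>. The lower
  bound holds because \<open>F \<psi>\<close> is nonzero near some \<open>\<eta>\<close>, and \<open>\<omega> \<mapsto> \<beta>(\<omega>) (\<xi> - \<omega>)\<close> takes the value \<open>\<eta>\<close> at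
  some \<open>\<omega>\<^sub>0\<close> and stays close to it on an interval of length comparable to \<open>1 / \<beta>(\<omega>\<^sub>0)\<close>.
\<close>

section \<open>Square-integrable functions\<close>

text \<open>Two obstacles shape the argument. The weak operator is tested against all of L2 and its
  defining integral must converge, so the energy bound has to reach arbitrary \<open>f\<close>
  before a form exists at all; and only the upper half of that bound survives Fatou. The lower half
  is carried over afterwards, by the continuity of the form that the upper half supplies.
  Continuous, bounded, integrable functions serve as the working class because it contains the
  convolution kernels, is closed under convolution and is dense in L2.

  The hypothesis \<open>\<alpha> < 1\<close> enters twice. It makes \<omega> \<mapsto>
  \<beta>(\<omega>) (\<xi> - \<omega>) unbounded in both directions, so that every \<eta> is
  reached. And with \<open>n * (1 - \<alpha>) \<ge> 1\<close> it leaves |F \<psi>|^2, at the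
  coordinates belonging to \<omega> far from \<xi>, of order (1 + |\<omega>|)^(-2), which is
  integrable with a bound independent of \<xi>. Since a finite order of decay, fixed by \<alpha>, is
  enough, the compactly supported example can be a function of finite smoothness chosen according to
  \<alpha>.\<close>

definition sq_integrable :: "'a measure \<Rightarrow> ('a \<Rightarrow> complex) \<Rightarrow> bool" where
  "sq_integrable M f \<longleftrightarrow> f \<in> borel_measurable M \<and> integrable M (\<lambda>t. (cmod (f t))\<^sup>2)"

lemma L2_iff: "f \<in> L2 \<longleftrightarrow> sq_integrable lborel f"
  by (auto simp: L2_def sq_integrable_def)

lemma borel_measurable_cnj [measurable]: "cnj \<in> borel_measurable borel"
  by (intro borel_measurable_continuous_onI continuous_intros)

lemma sq_integrable_prod:
  assumes "sq_integrable M f" "sq_integrable M g"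
  shows "integrable M (\<lambda>x. f x * cnj (g x))"
proof (rule Bochner_Integration.integrable_bound)
  show "integrable M (\<lambda>x. (cmod (f x))\<^sup>2 + (cmod (g x))\<^sup>2)"
    using assms by (auto simp: sq_integrable_def)
  show "(\<lambda>x. f x * cnj (g x)) \<in> borel_measurable M"
    using assms by (auto simp: sq_integrable_def)
  have "a * b \<le> a\<^sup>2 + b\<^sup>2" if "0 \<le> a" "0 \<le> b" for a b :: real
    using sum_squares_bound[of a b] that mult_nonneg_nonneg[of a b] by linarith
  then show "AE x in M. norm (f x * cnj (g x)) \<le> norm ((cmod (f x))\<^sup>2 + (cmod (g x))\<^sup>2)"
    by (simp add: norm_mult)
qed

lemma sq_integrable_add:
  assumes "sq_integrable M f" "sq_integrable M g"
  shows "sq_integrable M (\<lambda>x. f x + g x)"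
  unfolding sq_integrable_def
proof
  show "(\<lambda>x. f x + g x) \<in> borel_measurable M"
    using assms by (auto simp: sq_integrable_def)
  show "integrable M (\<lambda>x. (cmod (f x + g x))\<^sup>2)"
  proof (rule Bochner_Integration.integrable_bound)
    show "integrable M (\<lambda>x. 2 * (cmod (f x))\<^sup>2 + 2 * (cmod (g x))\<^sup>2)"
      using assms by (auto simp: sq_integrable_def)
    show "(\<lambda>x. (cmod (f x + g x))\<^sup>2) \<in> borel_measurable M"
      using assms by (auto simp: sq_integrable_def)
    have "(cmod (a + b))\<^sup>2 \<le> 2 * (cmod a)\<^sup>2 + 2 * (cmod b)\<^sup>2" for a b
      using power_mono[OF norm_triangle_ineq[of a b], of 2] sum_squares_bound[of "cmod a" "cmod b"]
      by (simp add: power2_sum)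
    then show "AE x in M. norm ((cmod (f x + g x))\<^sup>2) \<le> norm (2 * (cmod (f x))\<^sup>2 + 2 * (cmod (g x))\<^sup>2)"
      by simp
  qed
qed

lemma sq_integrable_scale: "sq_integrable M f \<Longrightarrow> sq_integrable M (\<lambda>x. c * f x)"
  by (auto simp: sq_integrable_def norm_mult power_mult_distrib)

lemma sq_integrable_diff:
  assumes "sq_integrable M f" "sq_integrable M g"
  shows "sq_integrable M (\<lambda>x. f x - g x)"
  using sq_integrable_add[OF assms(1) sq_integrable_scale[OF assms(2), of "-1"]] by simp

text \<open>Evaluation at the minimum \<open>s = b / c\<close>. For \<open>c = 0\<close> a nonzero
  slope would make the value at \<open>(a + 1) / b\<close> equal to \<open>- a - 2\<close>.\<close>

lemma quadratic_form_discriminant: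
  fixes a b c :: real
  assumes pos: "\<And>s. 0 \<le> a - 2 * s * b + s\<^sup>2 * c" and "0 \<le> a" "0 \<le> c" "0 \<le> b"
  shows "b\<^sup>2 \<le> a * c"
proof (cases "c = 0")
  case True
  have "b = 0"
  proof (rule ccontr)
    assume "b \<noteq> 0"
    with pos[of "(a + 1) / b"] True \<open>0 \<le> a\<close> show False by simp
  qed
  then show ?thesis using True by simp
next
  case False
  with pos[of "b / c"] \<open>0 \<le> c\<close> show ?thesis
    by (simp add: field_simps power2_eq_square)
qed

lemma Cauchy_Schwarz_integral:
  assumes "sq_integrable M f" "sq_integrable M g"
  shows "(LINT x|M. cmod (f x) * cmod (g x)) \<le>
         sqrt (LINT x|M. (cmod (f x))\<^sup>2) * sqrt (LINT x|M. (cmod (g x))\<^sup>2)"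
proof -
  let ?F = "LINT x|M. (cmod (f x))\<^sup>2" and ?G = "LINT x|M. (cmod (g x))\<^sup>2"
  let ?I = "LINT x|M. cmod (f x) * cmod (g x)"
  have int: "integrable M (\<lambda>x. cmod (f x) * cmod (g x))"
    using integrable_norm[OF sq_integrable_prod[OF assms]] by (simp add: norm_mult)
  have intf: "integrable M (\<lambda>x. (cmod (f x))\<^sup>2)" "integrable M (\<lambda>x. (cmod (g x))\<^sup>2)"
    using assms by (auto simp: sq_integrable_def)
  have nn: "?F \<ge> 0" "?G \<ge> 0" "?I \<ge> 0" by auto
  have key: "0 \<le> ?F - 2 * s * ?I + s\<^sup>2 * ?G" for s :: real
  proof -
    have "0 \<le> (LINT x|M. (cmod (f x) - s * cmod (g x))\<^sup>2)" by simp
    also have "\<dots> = (LINT x|M. ((cmod (f x))\<^sup>2 - (2 * s) * (cmod (f x) * cmod (g x))) + s\<^sup>2 * (cmod (g x))\<^sup>2)"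
      by (simp add: power2_eq_square algebra_simps)
    also have "\<dots> = ?F - 2 * s * ?I + s\<^sup>2 * ?G"
      using int intf by simp
    finally show ?thesis .
  qed
  have "?I\<^sup>2 \<le> ?F * ?G"
    using quadratic_form_discriminant[OF key nn] .
  then have "?I \<le> sqrt (?F * ?G)" by (rule real_le_rsqrt)
  then show ?thesis by (simp add: real_sqrt_mult)
qed

lemma Cauchy_Schwarz_integral_cnj:
  assumes "sq_integrable M f" "sq_integrable M g"
  shows "cmod (LINT x|M. f x * cnj (g x)) \<le>
         sqrt (LINT x|M. (cmod (f x))\<^sup>2) * sqrt (LINT x|M. (cmod (g x))\<^sup>2)"
proof -
  have "cmod (LINT x|M. f x * cnj (g x)) \<le> (LINT x|M. cmod (f x * cnj (g x)))"
    by (rule integral_norm_bound)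
  also have "\<dots> = (LINT x|M. cmod (f x) * cmod (g x))" by (simp add: norm_mult)
  finally show ?thesis using Cauchy_Schwarz_integral[OF assms] by linarith
qed

lemma L2_add: "f \<in> L2 \<Longrightarrow> g \<in> L2 \<Longrightarrow> (\<lambda>t. f t + g t) \<in> L2"
  by (simp add: L2_iff sq_integrable_add)

lemma L2_diff: "f \<in> L2 \<Longrightarrow> g \<in> L2 \<Longrightarrow> (\<lambda>t. f t - g t) \<in> L2"
  by (simp add: L2_iff sq_integrable_diff)

lemma L2_scale: "f \<in> L2 \<Longrightarrow> (\<lambda>t. c * f t) \<in> L2"
  by (simp add: L2_iff sq_integrable_scale)

lemma L2_measurable: "f \<in> L2 \<Longrightarrow> f \<in> borel_measurable borel"
  by (simp add: L2_def)

lemma L2_norm_nonneg [simp]: "0 \<le> L2_norm f"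
  by (simp add: L2_norm_def)

lemma L2_norm_power2: "(L2_norm f)\<^sup>2 = (LINT t|lborel. (cmod (f t))\<^sup>2)"
  by (simp add: L2_norm_def)

lemma nn_integral_L2_norm:
  "f \<in> L2 \<Longrightarrow> (\<integral>\<^sup>+t. ennreal ((cmod (f t))\<^sup>2) \<partial>lborel) = ennreal ((L2_norm f)\<^sup>2)"
  by (simp add: L2_norm_power2 L2_def nn_integral_eq_integral)

lemma L2_inner_bound: "f \<in> L2 \<Longrightarrow> g \<in> L2 \<Longrightarrow> cmod (L2_inner f g) \<le> L2_norm f * L2_norm g"
  using Cauchy_Schwarz_integral_cnj[of lborel f g] by (simp add: L2_iff L2_inner_def L2_norm_def)

lemma L2_inner_add_left:
  "f \<in> L2 \<Longrightarrow> g \<in> L2 \<Longrightarrow> h \<in> L2 \<Longrightarrow> L2_inner (\<lambda>t. f t + g t) h = L2_inner f h + L2_inner g h"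
  unfolding L2_inner_def L2_iff distrib_right
  by (intro Bochner_Integration.integral_add sq_integrable_prod)

lemma L2_inner_diff_left:
  "f \<in> L2 \<Longrightarrow> g \<in> L2 \<Longrightarrow> h \<in> L2 \<Longrightarrow> L2_inner (\<lambda>t. f t - g t) h = L2_inner f h - L2_inner g h"
  unfolding L2_inner_def L2_iff left_diff_distrib
  by (intro Bochner_Integration.integral_diff sq_integrable_prod)

lemma L2_inner_scale_left: "L2_inner (\<lambda>t. c * f t) h = c * L2_inner f h"
  by (simp add: L2_inner_def mult.assoc)

lemma L2_inner_commute: "L2_inner g f = cnj (L2_inner f g)"
proof -
  have "cnj (L2_inner f g) = (LINT t|lborel. cnj (f t * cnj (g t)))"
    unfolding L2_inner_def by (rule Bochner_Integration.integral_cnj[symmetric])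
  then show ?thesis by (simp add: L2_inner_def mult.commute)
qed

lemma L2_inner_self: "L2_inner f f = of_real ((L2_norm f)\<^sup>2)"
  unfolding L2_inner_def L2_norm_power2 complex_norm_square[symmetric]
  by (simp flip: of_real_power)

lemma L2_norm_eq_0_iff:
  assumes "f \<in> L2"
  shows "L2_norm f = 0 \<longleftrightarrow> L2_eq f (\<lambda>_. 0)"
proof -
  have "L2_norm f = 0 \<longleftrightarrow> (LINT t|lborel. (cmod (f t))\<^sup>2) = 0"
    by (simp add: L2_norm_def)
  also have "\<dots> \<longleftrightarrow> (AE t in lborel. (cmod (f t))\<^sup>2 = 0)"
    using assms by (intro integral_nonneg_eq_0_iff_AE) (auto simp: L2_def)
  finally show ?thesis by (simp add: L2_eq_def)
qed

lemma integrable_inverse_1_plus_square_lborel: "integrable lborel (\<lambda>x::real. inverse (1 + x\<^sup>2))"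
  using integrable_inverse_1_plus_square by (simp add: set_integrable_def einterval_def)

lemma weight_L2: "(\<lambda>x. of_real (inverse (1 + x\<^sup>2))) \<in> L2"
proof -
  have "integrable lborel (\<lambda>x::real. (inverse (1 + x\<^sup>2))\<^sup>2)"
  proof (rule Bochner_Integration.integrable_bound[OF integrable_inverse_1_plus_square_lborel])
    have "(inverse (1 + x\<^sup>2))\<^sup>2 \<le> inverse (1 + x\<^sup>2)" for x :: real
      using power_decreasing[of 1 2 "inverse (1 + x\<^sup>2)"] by (simp add: inverse_le_1_iff)
    then show "AE x in lborel. norm ((inverse (1 + x\<^sup>2))\<^sup>2) \<le> norm (inverse (1 + x\<^sup>2 :: real))"
      by simp
  qed simp
  then show ?thesis by (simp add: L2_def del: of_real_inverse)
qed

text \<open>Multiplication by the square-integrable weight \<open>1 / (1 + x\<^sup>2)\<close> turns an \<open>L\<^sup>2\<close>-Cauchy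
  sequence into an \<open>L\<^sup>1\<close>-Cauchy one, which has an almost everywhere convergent subsequence.\<close>

lemma L2_complete:
  assumes L2: "\<And>n. s n \<in> L2"
    and Cauchy: "\<And>e. 0 < e \<Longrightarrow> \<exists>N. \<forall>i\<ge>N. \<forall>j\<ge>N. L2_norm (\<lambda>t. s i t - s j t) < e"
  obtains h where "h \<in> L2" "(\<lambda>n. L2_norm (\<lambda>t. h t - s n t)) \<longlonglongrightarrow> 0"
proof -
  define w :: "real \<Rightarrow> complex" where "w = (\<lambda>x. of_real (inverse (1 + x\<^sup>2)))"
  have w: "w \<in> L2" using weight_L2 by (simp add: w_def)
  have cw: "cnj (w x) = w x" and w0: "w x \<noteq> 0" for x
    by (simp_all add: w_def add_nonneg_eq_0_iff del: of_real_inverse of_real_add of_real_power)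
  have [measurable]: "w \<in> borel_measurable borel" "s n \<in> borel_measurable borel" for n
    using w L2 by (auto simp: L2_def)
  have int: "integrable lborel (\<lambda>x. s n x * w x)" for n
    using sq_integrable_prod[of lborel "s n" w] L2[of n] w by (simp add: L2_iff cw)
  have "\<exists>N. \<forall>i\<ge>N. \<forall>j\<ge>N. (LINT x|lborel. norm (s i x * w x - s j x * w x)) < e" if "e > 0" for e
  proof -
    obtain N where N: "L2_norm (\<lambda>t. s i t - s j t) < e / (L2_norm w + 1)" if "i \<ge> N" "j \<ge> N" for i j
      using Cauchy[of "e / (L2_norm w + 1)"] \<open>e > 0\<close> by (auto simp: add_nonneg_pos)
    have "(LINT x|lborel. norm (s i x * w x - s j x * w x)) < e" if "i \<ge> N" "j \<ge> N" for i j
    proof -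
      have "(LINT x|lborel. norm (s i x * w x - s j x * w x)) = (LINT x|lborel. cmod (s i x - s j x) * cmod (w x))"
        by (simp add: left_diff_distrib[symmetric] norm_mult)
      also have "\<dots> \<le> L2_norm (\<lambda>t. s i t - s j t) * L2_norm w"
        unfolding L2_norm_def using L2_diff[OF L2 L2] w
        by (intro Cauchy_Schwarz_integral) (auto simp: L2_iff)
      also have "\<dots> \<le> L2_norm (\<lambda>t. s i t - s j t) * (L2_norm w + 1)"
        by (intro mult_left_mono) auto
      also have "\<dots> < e"
        using N[OF that] by (simp add: pos_less_divide_eq add_nonneg_pos)
      finally show ?thesis .
    qed
    then show ?thesis by blast
  qed
  with int obtain r where r: "strict_mono r" "AE x in lborel. Cauchy (\<lambda>i. s (r i) x * w x)"
    by (rule cauchy_L1_AE_cauchy_subseq)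
  define h where "h x = lim (\<lambda>i. s (r i) x * w x) / w x" for x
  have [measurable]: "h \<in> borel_measurable borel" unfolding h_def by measurable
  have lim: "AE x in lborel. (\<lambda>i. s (r i) x) \<longlonglongrightarrow> h x"
    using r(2)
  proof eventually_elim
    case (elim x)
    then have "(\<lambda>i. s (r i) x * w x) \<longlonglongrightarrow> lim (\<lambda>i. s (r i) x * w x)"
      by (simp add: Cauchy_convergent_iff convergent_LIMSEQ_iff)
    from tendsto_divide[OF this tendsto_const[of "w x"] w0] show ?case
      by (simp add: h_def w0)
  qed
  \<comment> \<open>Only one index runs along the subsequence while \<open>n\<close> stays fixed;
    this yields convergence of the whole sequence and not just of the subsequence.\<close>
  have Fatou: "(\<integral>\<^sup>+x. ennreal ((cmod (h x - s n x))\<^sup>2) \<partial>lborel) \<le> ennreal (e\<^sup>2)"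
    if N: "\<And>i. i \<ge> N \<Longrightarrow> L2_norm (\<lambda>t. s i t - s n t) < e" and "e > 0" for n N e
  proof -
    have "(\<integral>\<^sup>+x. ennreal ((cmod (h x - s n x))\<^sup>2) \<partial>lborel) =
          (\<integral>\<^sup>+x. liminf (\<lambda>i. ennreal ((cmod (s (r i) x - s n x))\<^sup>2)) \<partial>lborel)"
    proof (rule nn_integral_cong_AE)
      show "AE x in lborel. ennreal ((cmod (h x - s n x))\<^sup>2) = liminf (\<lambda>i. ennreal ((cmod (s (r i) x - s n x))\<^sup>2))"
        using lim
      proof eventually_elim
        case (elim x)
        then have "(\<lambda>i. ennreal ((cmod (s (r i) x - s n x))\<^sup>2)) \<longlonglongrightarrow> ennreal ((cmod (h x - s n x))\<^sup>2)"
          by (intro tendsto_ennrealI tendsto_intros)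
        then show ?case by (intro lim_imp_Liminf[symmetric]) auto
      qed
    qed
    also have "\<dots> \<le> liminf (\<lambda>i. \<integral>\<^sup>+x. ennreal ((cmod (s (r i) x - s n x))\<^sup>2) \<partial>lborel)"
      by (intro nn_integral_liminf) auto
    also have "\<dots> = liminf (\<lambda>i. ennreal ((L2_norm (\<lambda>t. s (r i) t - s n t))\<^sup>2))"
      by (simp add: nn_integral_L2_norm L2_diff L2)
    also have "\<dots> \<le> ennreal (e\<^sup>2)"
    proof -
      have "\<forall>\<^sub>F i in sequentially. ennreal ((L2_norm (\<lambda>t. s (r i) t - s n t))\<^sup>2) \<le> ennreal (e\<^sup>2)"
        using eventually_ge_at_top[of N]
      proof eventually_elim
        case (elim i)
        have "r i \<ge> N" using seq_suble[OF r(1), of i] elim by simp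
        from N[OF this] show ?case by (intro ennreal_leI power_mono) auto
      qed
      then show ?thesis by (intro order_trans[OF Liminf_le_Limsup Limsup_bounded]) auto
    qed
    finally show ?thesis .
  qed
  have diff_L2: "(\<lambda>t. h t - s n t) \<in> L2" and diff_norm: "L2_norm (\<lambda>t. h t - s n t) \<le> e"
    if N: "\<And>i. i \<ge> N \<Longrightarrow> L2_norm (\<lambda>t. s i t - s n t) < e" and "e > 0" for n N e
  proof -
    note F = Fatou[OF N \<open>e > 0\<close>]
    have "(\<integral>\<^sup>+x. ennreal ((cmod (h x - s n x))\<^sup>2) \<partial>lborel) < \<infinity>"
      by (rule order_le_less_trans[OF F]) auto
    then have "integrable lborel (\<lambda>t. (cmod (h t - s n t))\<^sup>2)"
      by (intro integrableI_bounded) auto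
    then show L2: "(\<lambda>t. h t - s n t) \<in> L2" by (simp add: L2_def)
    have "ennreal ((L2_norm (\<lambda>t. h t - s n t))\<^sup>2) \<le> ennreal (e\<^sup>2)"
      using F nn_integral_L2_norm[OF L2] by simp
    then have "(L2_norm (\<lambda>t. h t - s n t))\<^sup>2 \<le> e\<^sup>2" by simp
    then show "L2_norm (\<lambda>t. h t - s n t) \<le> e" using \<open>e > 0\<close> by (simp add: power2_le_iff_abs_le)
  qed
  show thesis
  proof
    obtain N where "\<And>i. i \<ge> N \<Longrightarrow> L2_norm (\<lambda>t. s i t - s N t) < 1"
      using Cauchy[of 1] by auto
    from L2_add[OF diff_L2[OF this] L2[of N]] show "h \<in> L2" by simp
    show "(\<lambda>n. L2_norm (\<lambda>t. h t - s n t)) \<longlonglongrightarrow> 0"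
    proof (rule LIMSEQ_I)
      fix e :: real assume "0 < e"
      then obtain N where N: "\<And>i j. i \<ge> N \<Longrightarrow> j \<ge> N \<Longrightarrow> L2_norm (\<lambda>t. s i t - s j t) < e / 2"
        using Cauchy[of "e / 2"] by auto
      have "L2_norm (\<lambda>t. h t - s n t) \<le> e / 2" if "n \<ge> N" for n
        using diff_norm[of N n "e / 2"] N that \<open>0 < e\<close> by auto
      then show "\<exists>no. \<forall>n\<ge>no. norm (L2_norm (\<lambda>t. h t - s n t) - 0) < e"
        using \<open>0 < e\<close> by (intro exI[of _ N]) (force intro: order_le_less_trans)
    qed
  qed
qed

section \<open>Coercive hermitian forms\<close>

text \<open>The vanishing of the first variation at a minimum. At
  \<open>t = - p / (\<bar>q\<bar> + 1)\<close> the expression is at most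
  \<open>- p^2 / (\<bar>q\<bar> + 1)\<close>, since the quadratic term cancels at most half of the
  linear one.\<close>

lemma real_linear_part_0:
  fixes p q :: real
  assumes "\<And>t. 0 \<le> 2 * t * p + t\<^sup>2 * q"
  shows "p = 0"
proof (rule ccontr)
  assume "p \<noteq> 0"
  have *: "0 \<le> 2 * (- p / (\<bar>q\<bar> + 1)) * p + (- p / (\<bar>q\<bar> + 1))\<^sup>2 * q" by (rule assms)
  have "(- p / (\<bar>q\<bar> + 1))\<^sup>2 * q \<le> (p / (\<bar>q\<bar> + 1))\<^sup>2 * (\<bar>q\<bar> + 1)"
    by (simp add: mult_left_mono)
  also have "\<dots> = p\<^sup>2 / (\<bar>q\<bar> + 1)" by (simp add: power2_eq_square)
  finally have "0 \<le> - (p\<^sup>2 / (\<bar>q\<bar> + 1))"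
    using * by (simp add: power2_eq_square)
  moreover have "0 < p\<^sup>2 / (\<bar>q\<bar> + 1)" using \<open>p \<noteq> 0\<close> by (simp add: add_nonneg_pos)
  ultimately show False by linarith
qed

text \<open>Covers both the L2 inner product (\<open>A = B = 1\<close>) and the energy form of the
  transform, so that a single representation theorem produces the operator and its inverse.\<close>

locale coercive_form =
  fixes e :: "(real \<Rightarrow> complex) \<Rightarrow> (real \<Rightarrow> complex) \<Rightarrow> complex" and A B :: real
  assumes add_left: "f \<in> L2 \<Longrightarrow> g \<in> L2 \<Longrightarrow> h \<in> L2 \<Longrightarrow> e (\<lambda>t. f t + g t) h = e f h + e g h"
    and scale_left: "f \<in> L2 \<Longrightarrow> h \<in> L2 \<Longrightarrow> e (\<lambda>t. c * f t) h = c * e f h"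
    and hermitian: "f \<in> L2 \<Longrightarrow> g \<in> L2 \<Longrightarrow> e g f = cnj (e f g)"
    and bounded: "f \<in> L2 \<Longrightarrow> g \<in> L2 \<Longrightarrow> cmod (e f g) \<le> B * L2_norm f * L2_norm g"
    and coercive: "f \<in> L2 \<Longrightarrow> A * (L2_norm f)\<^sup>2 \<le> Re (e f f)"
    and A_pos: "0 < A"
begin

lemma add_right: "f \<in> L2 \<Longrightarrow> g \<in> L2 \<Longrightarrow> h \<in> L2 \<Longrightarrow> e h (\<lambda>t. f t + g t) = e h f + e h g"
  using hermitian[of "\<lambda>t. f t + g t" h] hermitian[of f h] hermitian[of g h] add_left[of f g h]
  by (simp add: L2_add)

lemma scale_right: "f \<in> L2 \<Longrightarrow> h \<in> L2 \<Longrightarrow> e h (\<lambda>t. c * f t) = cnj c * e h f"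
  using hermitian[of "\<lambda>t. c * f t" h] hermitian[of f h] scale_left[of f h c]
  by (simp add: L2_scale)

lemma diff_left: "f \<in> L2 \<Longrightarrow> g \<in> L2 \<Longrightarrow> h \<in> L2 \<Longrightarrow> e (\<lambda>t. f t - g t) h = e f h - e g h"
  using add_left[of f "\<lambda>t. - 1 * g t" h] scale_left[of g h "-1"] L2_scale[of g "-1"] by simp

text \<open>Coercivity applied to the difference. This is how identities between form values become
  equations in L2.\<close>

lemma separating:
  assumes "f \<in> L2" "g \<in> L2" and eq: "\<And>h. h \<in> L2 \<Longrightarrow> e f h = e g h"
  shows "L2_eq f g"
proof -
  let ?d = "\<lambda>t. f t - g t"
  have d: "?d \<in> L2" using assms by (simp add: L2_diff)
  have "e ?d ?d = 0" using assms d by (simp add: diff_left)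
  with coercive[OF d] A_pos have "L2_norm ?d = 0" by (simp add: mult_le_0_iff)
  with d show ?thesis by (simp add: L2_norm_eq_0_iff L2_eq_def)
qed

text \<open>The representing function minimises \<open>e f f - 2 Re (\<phi> f)\<close>; minimising sequences are Cauchy by
  the parallelogram identity.\<close>

lemma Riesz_representation:
  fixes \<phi> :: "(real \<Rightarrow> complex) \<Rightarrow> complex"
  assumes add: "\<And>f g. f \<in> L2 \<Longrightarrow> g \<in> L2 \<Longrightarrow> \<phi> (\<lambda>t. f t + g t) = \<phi> f + \<phi> g"
    and scale: "\<And>c f. f \<in> L2 \<Longrightarrow> \<phi> (\<lambda>t. c * f t) = c * \<phi> f"
    and bdd: "\<And>f. f \<in> L2 \<Longrightarrow> cmod (\<phi> f) \<le> K * L2_norm f"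
  obtains h where "h \<in> L2" "\<And>g. g \<in> L2 \<Longrightarrow> e h g = cnj (\<phi> g)"
proof -
  define J where "J f = Re (e f f) - 2 * Re (\<phi> f)" for f
  \<comment> \<open>For real \<open>r\<close> the two hermitian cross terms add up to twice a real
    part.\<close>
  have J_scaled: "J (\<lambda>t. f t + of_real r * g t) = J f + 2 * r * (Re (e f g) - Re (\<phi> g)) + r\<^sup>2 * Re (e g g)"
    if "f \<in> L2" "g \<in> L2" for f g r
    using that
    by (simp add: J_def add scale add_left add_right scale_left scale_right L2_add L2_scale
        hermitian[of f g] power2_eq_square algebra_simps)
  \<comment> \<open>With \<open>N = L2_norm f\<close>, coercivity and the bound on \<phi> give
    \<open>J f \<ge> A * N^2 - 2 * K * N\<close>; completing the square yields
    \<open>- K^2 / A\<close>.\<close>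
  have J_lower: "- (K\<^sup>2 / A) \<le> J f" if "f \<in> L2" for f
  proof -
    have "0 \<le> (A * L2_norm f - K)\<^sup>2" by simp
    then have "2 * K * L2_norm f \<le> A * (L2_norm f)\<^sup>2 + K\<^sup>2 / A"
      using A_pos by (simp add: field_simps power2_eq_square)
    then show ?thesis
      using coercive[OF that] bdd[OF that] complex_Re_le_cmod[of "\<phi> f"] by (simp add: J_def)
  qed
  define I where "I = Inf (J ` L2)"
  have "(\<lambda>t. 0) \<in> L2" by (simp add: L2_def)
  then have ne: "L2 \<noteq> {}" by blast
  have bb: "bdd_below (J ` L2)" using J_lower by (auto intro!: bdd_belowI2)
  have I_le: "I \<le> J f" if "f \<in> L2" for f
    unfolding I_def using that bb by (intro cINF_lower)
  have "\<exists>f\<in>L2. J f < I + 1 / Suc n" for n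
    using cINF_less_iff[OF ne bb, of "I + 1 / Suc n"] by (auto simp: I_def)
  then obtain s where s: "s n \<in> L2" "J (s n) < I + 1 / Suc n" for n by metis
  have dist: "A * (L2_norm (\<lambda>t. s i t - s j t))\<^sup>2 \<le> 2 * (1 / Suc i) + 2 * (1 / Suc j)" for i j
  proof -
    \<comment> \<open>The midpoint of \<open>s i\<close> and \<open>s j\<close>. As \<open>J\<close>
      cannot fall below \<open>I\<close> there, the form value of the difference is at most twice
      the sum of the two excesses over \<open>I\<close>.\<close>
    let ?m = "\<lambda>t. s j t + of_real (1/2) * (s i t - s j t)"
    let ?d = "\<lambda>t. s i t - s j t"
    have d: "?d \<in> L2" by (intro L2_diff s)
    have "I \<le> J ?m" by (intro I_le L2_add L2_scale d s)
    moreover have "J ?m = J (s j) + (Re (e (s j) ?d) - Re (\<phi> ?d)) + Re (e ?d ?d) / 4"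
      using J_scaled[OF s(1) d, of j "1/2"] by (simp add: power2_eq_square)
    moreover have "J (s i) = J (s j) + 2 * (Re (e (s j) ?d) - Re (\<phi> ?d)) + Re (e ?d ?d)"
      using J_scaled[OF s(1) d, of j 1] by simp
    ultimately have "Re (e ?d ?d) \<le> 2 * (J (s i) - I) + 2 * (J (s j) - I)" by argo
    then show ?thesis using coercive[OF d] s(2)[of i] s(2)[of j] by argo
  qed
  have "\<exists>N. \<forall>i\<ge>N. \<forall>j\<ge>N. L2_norm (\<lambda>t. s i t - s j t) < \<epsilon>" if "\<epsilon> > 0" for \<epsilon>
  proof -
    obtain N where N: "1 / Suc N < A * \<epsilon>\<^sup>2 / 4"
      using nat_approx_posE[of "A * \<epsilon>\<^sup>2 / 4"] A_pos \<open>\<epsilon> > 0\<close> by auto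
    have "L2_norm (\<lambda>t. s i t - s j t) < \<epsilon>" if "i \<ge> N" "j \<ge> N" for i j
    proof -
      have "1 / Suc i \<le> 1 / Suc N" "1 / Suc j \<le> 1 / Suc N" using that by (auto simp: frac_le)
      with dist[of i j] N have "A * (L2_norm (\<lambda>t. s i t - s j t))\<^sup>2 < A * \<epsilon>\<^sup>2" by linarith
      then have "(L2_norm (\<lambda>t. s i t - s j t))\<^sup>2 < \<epsilon>\<^sup>2" using A_pos by simp
      then show ?thesis using \<open>\<epsilon> > 0\<close> power_less_imp_less_base by fastforce
    qed
    then show ?thesis by blast
  qed
  with s(1) obtain h where h: "h \<in> L2" "(\<lambda>n. L2_norm (\<lambda>t. h t - s n t)) \<longlonglongrightarrow> 0"
    by (rule L2_complete)
  have "J h \<le> I"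
  proof (rule LIMSEQ_le_const)
    let ?d = "\<lambda>n t. h t - s n t"
    have d: "?d n \<in> L2" for n by (intro L2_diff h s)
    \<comment> \<open>Bounds the linear terms in the expansion of \<open>J (s n)\<close> around
      \<open>h\<close>. The quadratic term is nonnegative and has the favourable sign for an upper
      bound on \<open>J h\<close>.\<close>
    define E where "E n = 2 * (B * L2_norm h * L2_norm (?d n) + K * L2_norm (?d n))" for n
    have "E \<longlonglongrightarrow> 2 * (B * L2_norm h * 0 + K * 0)" unfolding E_def by (intro tendsto_intros h)
    then show "(\<lambda>n. I + 1 / Suc n + E n) \<longlonglongrightarrow> I"
      using tendsto_add[OF tendsto_add[OF tendsto_const[of I] LIMSEQ_inverse_real_of_nat]]
      by (fastforce simp: inverse_eq_divide)
    have "J h \<le> I + 1 / Suc n + E n" for n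
    proof -
      have "J (s n) = J h - 2 * (Re (e h (?d n)) - Re (\<phi> (?d n))) + Re (e (?d n) (?d n))"
        using J_scaled[OF h(1) d, of "-1" n] by simp
      moreover have "0 \<le> Re (e (?d n) (?d n))"
        using coercive[OF d, of n] A_pos by (meson less_imp_le mult_nonneg_nonneg order_trans zero_le_power2)
      moreover have "\<bar>Re (e h (?d n))\<bar> \<le> B * L2_norm h * L2_norm (?d n)"
        using bounded[OF h(1) d, of n] abs_Re_le_cmod[of "e h (?d n)"] by linarith
      moreover have "\<bar>Re (\<phi> (?d n))\<bar> \<le> K * L2_norm (?d n)"
        using bdd[OF d, of n] abs_Re_le_cmod[of "\<phi> (?d n)"] by linarith
      ultimately show ?thesis using s(2)[of n] unfolding E_def by argo
    qed
    then show "\<exists>N. \<forall>n\<ge>N. J h \<le> I + 1 / Suc n + E n" by blast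
  qed
  have Re_eq: "Re (e h g) = Re (\<phi> g)" if "g \<in> L2" for g
  proof -
    have "0 \<le> 2 * r * (Re (e h g) - Re (\<phi> g)) + r\<^sup>2 * Re (e g g)" for r
      using J_scaled[OF h(1) that, of r] I_le[OF L2_add[OF h(1) L2_scale[OF that]], of "of_real r"] \<open>J h \<le> I\<close>
      by linarith
    from real_linear_part_0[OF this] show ?thesis by simp
  qed
  show thesis
  proof
    fix g assume g: "g \<in> L2"
    \<comment> \<open>The variation controls real parts only; testing with \<open>\<i> * g\<close>
      recovers the imaginary part.\<close>
    have "Re (e h (\<lambda>t. \<i> * g t)) = Re (\<phi> (\<lambda>t. \<i> * g t))" using g by (intro Re_eq L2_scale)
    with Re_eq[OF g] show "e h g = cnj (\<phi> g)"
      using g h by (simp add: scale scale_right complex_eq_iff)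
  qed (fact h)
qed

end

lemma coercive_form_L2_inner: "coercive_form L2_inner 1 1"
  by unfold_locales
    (simp_all add: L2_inner_add_left L2_inner_scale_left L2_inner_commute[symmetric] L2_inner_bound L2_inner_self)

lemma form_operator:
  assumes "coercive_form p A B" "coercive_form q A' B'"
  obtains T where "L2_bounded_operator T" "\<And>f g. f \<in> L2 \<Longrightarrow> g \<in> L2 \<Longrightarrow> p (T f) g = q f g"
proof -
  interpret p: coercive_form p A B by fact
  interpret q: coercive_form q A' B' by fact
  have "\<exists>h\<in>L2. \<forall>g\<in>L2. p h g = q f g" if f: "f \<in> L2" for f
  proof -
    have "\<exists>h. h \<in> L2 \<and> (\<forall>g. g \<in> L2 \<longrightarrow> p h g = cnj (q g f))"
    proof (rule p.Riesz_representation[where \<phi> = "\<lambda>g. q g f" and K = "B' * L2_norm f"])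
      show "cmod (q g f) \<le> B' * L2_norm f * L2_norm g" if "g \<in> L2" for g
        using q.bounded[OF that f] by (simp add: mult_ac)
    qed (use f q.add_left q.scale_left in auto)
    then show ?thesis using q.hermitian f by metis
  qed
  then obtain T where T: "\<And>f. f \<in> L2 \<Longrightarrow> T f \<in> L2" "\<And>f g. f \<in> L2 \<Longrightarrow> g \<in> L2 \<Longrightarrow> p (T f) g = q f g"
    by metis
  have bound: "L2_norm (T f) \<le> (\<bar>B'\<bar> / A) * L2_norm f" if f: "f \<in> L2" for f
  proof (cases "L2_norm (T f) = 0")
    case True
    then show ?thesis using p.A_pos by simp
  next
    case False
    then have pos: "0 < L2_norm (T f)" by (simp add: order_less_le)
    have "A * (L2_norm (T f))\<^sup>2 \<le> Re (q f (T f))" using p.coercive[OF T(1)[OF f]] T f by simp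
    also have "\<dots> \<le> B' * L2_norm f * L2_norm (T f)"
      using complex_Re_le_cmod q.bounded[OF f T(1)[OF f]] by (rule order_trans)
    also have "\<dots> \<le> \<bar>B'\<bar> * L2_norm f * L2_norm (T f)" by (intro mult_right_mono) auto
    finally have "(A * L2_norm (T f)) * L2_norm (T f) \<le> (\<bar>B'\<bar> * L2_norm f) * L2_norm (T f)"
      by (simp add: power2_eq_square mult_ac)
    then have "A * L2_norm (T f) \<le> \<bar>B'\<bar> * L2_norm f" using pos by simp
    then show ?thesis using p.A_pos by (simp add: field_simps)
  qed
  have "L2_bounded_operator T"
    unfolding L2_bounded_operator_def
  proof (intro conjI ballI allI impI exI)
    fix f g assume fg: "f \<in> L2" "g \<in> L2"
    show "L2_eq (T (\<lambda>t. f t + g t)) (\<lambda>t. T f t + T g t)"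
      using fg by (intro p.separating) (simp_all add: T L2_add q.add_left p.add_left)
    assume "L2_eq f g"
    \<comment> \<open>Forms are not assumed to respect equality almost everywhere; boundedness
      supplies it, since a null function has norm 0 and so has its image.\<close>
    then have "L2_norm (\<lambda>t. f t - g t) = 0"
      using fg by (simp add: L2_norm_eq_0_iff L2_diff L2_eq_def)
    with bound[OF L2_diff[OF fg]] have d: "L2_norm (T (\<lambda>t. f t - g t)) = 0"
      by (simp add: order_antisym)
    show "L2_eq (T f) (T g)"
    proof (intro p.separating)
      fix h assume h: "h \<in> L2"
      have "p (T f) h - p (T g) h = p (T (\<lambda>t. f t - g t)) h"
        using fg h by (simp add: T L2_diff q.diff_left)
      also have "\<dots> = 0"
        using p.bounded[OF T(1)[OF L2_diff[OF fg]] h] d by simp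
      finally show "p (T f) h = p (T g) h" by simp
    qed (use fg T in auto)
  next
    fix c f assume f: "f \<in> L2"
    show "L2_eq (T (\<lambda>t. c * f t)) (\<lambda>t. c * T f t)"
      using f by (intro p.separating) (simp_all add: T L2_scale q.scale_left p.scale_left)
    show "L2_norm (T f) \<le> (\<bar>B'\<bar> / A) * L2_norm f" by (rule bound[OF f])
  qed (use T in auto)
  then show thesis using T(2) by (rule that)
qed

text \<open>The inverse \<open>S\<close> arises by exchanging the two forms:
  \<open>q (S (T f)) g = L2_inner (T f) g = q f g\<close> and
  \<open>L2_inner (T (S f)) g = q (S f) g = L2_inner f g\<close>.\<close>

lemma form_operator_invertible:
  assumes q: "coercive_form q A B"
  obtains T where "L2_bounded_operator T" "L2_boundedly_invertible T"
    "\<And>f g. f \<in> L2 \<Longrightarrow> g \<in> L2 \<Longrightarrow> L2_inner (T f) g = q f g"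
proof -
  interpret q: coercive_form q A B by fact
  interpret i: coercive_form L2_inner 1 1 by (rule coercive_form_L2_inner)
  obtain T where T: "L2_bounded_operator T" "\<And>f g. f \<in> L2 \<Longrightarrow> g \<in> L2 \<Longrightarrow> L2_inner (T f) g = q f g"
    using form_operator[OF coercive_form_L2_inner q] by metis
  obtain S where S: "L2_bounded_operator S" "\<And>f g. f \<in> L2 \<Longrightarrow> g \<in> L2 \<Longrightarrow> q (S f) g = L2_inner f g"
    using form_operator[OF q coercive_form_L2_inner] by metis
  have mem: "T f \<in> L2" "S f \<in> L2" if "f \<in> L2" for f
    using S(1) T(1) that by (auto simp: L2_bounded_operator_def)
  have "L2_eq (S (T f)) f \<and> L2_eq (T (S f)) f" if "f \<in> L2" for f
    using that by (intro conjI q.separating i.separating) (simp_all add: mem S T)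
  with S(1) have "L2_boundedly_invertible T" by (auto simp: L2_boundedly_invertible_def)
  with T show thesis by (intro that)
qed

section \<open>Fourier transform and Plancherel identity\<close>

definition fourier :: "(real \<Rightarrow> complex) \<Rightarrow> real \<Rightarrow> complex" where
  "fourier f \<xi> = (LINT t|lborel. f t * cis (- (2 * pi * \<xi> * t)))"

text \<open>Integrability makes the Fourier integral converge, boundedness then gives membership in
  L2, and continuity makes local averages converge at every point.\<close>

definition cont_bdd_int :: "(real \<Rightarrow> complex) \<Rightarrow> bool" where
  "cont_bdd_int f \<longleftrightarrow> continuous_on UNIV f \<and> bounded (range f) \<and> integrable lborel f"

lemma borel_measurable_cis [measurable]: "cis \<in> borel_measurable borel"
  by (intro borel_measurable_continuous_onI continuous_intros)

lemma cont_bdd_int_measurable: "cont_bdd_int f \<Longrightarrow> f \<in> borel_measurable borel"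
  by (simp add: cont_bdd_int_def borel_measurable_continuous_onI)

lemma cont_bdd_int_bounded:
  assumes "cont_bdd_int f"
  shows "\<exists>C\<ge>0. \<forall>x. cmod (f x) \<le> C"
  using assms unfolding cont_bdd_int_def bounded_iff by (metis norm_ge_zero order_trans rangeI)

lemma cont_bdd_int_L2:
  assumes "cont_bdd_int f"
  shows "f \<in> L2"
proof -
  obtain C where C: "0 \<le> C" "\<And>x. cmod (f x) \<le> C" using cont_bdd_int_bounded[OF assms] by blast
  have [measurable]: "f \<in> borel_measurable borel" using assms by (rule cont_bdd_int_measurable)
  have "integrable lborel (\<lambda>t. (cmod (f t))\<^sup>2)"
  proof (rule Bochner_Integration.integrable_bound)
    show "integrable lborel (\<lambda>t. C * cmod (f t))" using assms by (simp add: cont_bdd_int_def)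
    show "AE t in lborel. norm ((cmod (f t))\<^sup>2) \<le> norm (C * cmod (f t))"
      using C by (simp add: power2_eq_square mult_right_mono)
  qed simp
  then show ?thesis by (simp add: L2_def)
qed

lemma integrable_mult_unimodular:
  assumes "integrable M f" "g \<in> borel_measurable M" "\<And>x. cmod (g x) \<le> 1"
  shows "integrable M (\<lambda>x. f x * g x)"
proof (rule Bochner_Integration.integrable_bound[OF assms(1)])
  show "(\<lambda>x. f x * g x) \<in> borel_measurable M"
    using assms by (auto dest: borel_measurable_integrable)
  show "AE x in M. norm (f x * g x) \<le> norm (f x)"
    using assms(3) by (simp add: norm_mult mult_left_le)
qed

lemma integrable_fourier: "integrable lborel f \<Longrightarrow> integrable lborel (\<lambda>t. f t * cis (- (2 * pi * \<xi> * t)))"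
  by (intro integrable_mult_unimodular) auto

lemma fourier_bound: "cmod (fourier f \<xi>) \<le> (LINT t|lborel. cmod (f t))"
  unfolding fourier_def by (rule order_trans[OF integral_norm_bound]) (simp add: norm_mult)

lemma continuous_fourier:
  assumes "integrable lborel f"
  shows "continuous_on UNIV (fourier f)"
proof -
  have [measurable]: "f \<in> borel_measurable borel" using borel_measurable_integrable[OF assms] by simp
  have "isCont (fourier f) \<xi>" for \<xi>
    unfolding continuous_at_sequentially comp_def fourier_def
  proof (intro allI impI)
    fix x assume x: "x \<longlonglongrightarrow> \<xi>"
    show "(\<lambda>n. LINT t|lborel. f t * cis (- (2 * pi * x n * t))) \<longlonglongrightarrow>
          (LINT t|lborel. f t * cis (- (2 * pi * \<xi> * t)))"
    proof (rule integral_dominated_convergence)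
      show "integrable lborel (\<lambda>t. cmod (f t))" using assms by simp
      show "AE t in lborel. (\<lambda>n. f t * cis (- (2 * pi * x n * t))) \<longlonglongrightarrow> f t * cis (- (2 * pi * \<xi> * t))"
        using x by (auto intro!: tendsto_intros)
    qed (auto simp: norm_mult)
  qed
  then show ?thesis by (simp add: continuous_at_imp_continuous_on)
qed

lemma fourier_measurable [measurable]:
  "integrable lborel f \<Longrightarrow> fourier f \<in> borel_measurable borel"
  by (intro borel_measurable_continuous_onI continuous_fourier)

text \<open>Justifies the later uses of Fubini in which \<open>u\<close> is a character of both
  variables.\<close>

lemma integrable_pair_mult:
  fixes f g :: "real \<Rightarrow> complex" and u :: "real \<times> real \<Rightarrow> complex"
  assumes f: "integrable lborel f" and g: "integrable lborel g"
    and [measurable]: "u \<in> borel_measurable (lborel \<Otimes>\<^sub>M lborel)" and u: "\<And>z. cmod (u z) \<le> 1"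
  shows "integrable (lborel \<Otimes>\<^sub>M lborel) (\<lambda>(x, y). f x * g y * u (x, y))"
proof -
  have [measurable]: "f \<in> borel_measurable borel" "g \<in> borel_measurable borel"
    using borel_measurable_integrable[OF f] borel_measurable_integrable[OF g] by auto
  have "integrable (lborel \<Otimes>\<^sub>M lborel) (\<lambda>(x, y). f x * g y)"
  proof (rule lborel_pair.Fubini_integrable)
    show "integrable lborel (\<lambda>x. LINT y|lborel. cmod (case (x, y) of (x, y) \<Rightarrow> f x * g y))"
      using f by (simp add: norm_mult)
    show "AE x in lborel. integrable lborel (\<lambda>y. case (x, y) of (x, y) \<Rightarrow> f x * g y)"
      using g by simp
  qed measurable
  then have "integrable (lborel \<Otimes>\<^sub>M lborel) (\<lambda>z. (case z of (x, y) \<Rightarrow> f x * g y) * u z)"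
    using u by (intro integrable_mult_unimodular) auto
  then show ?thesis by (simp add: case_prod_unfold)
qed

lemma cnj_fourier: "cnj (fourier f \<xi>) = (LINT t|lborel. cnj (f t) * cis (2 * pi * \<xi> * t))"
proof -
  have "cnj (fourier f \<xi>) = (LINT t|lborel. cnj (f t * cis (- (2 * pi * \<xi> * t))))"
    unfolding fourier_def by (rule Bochner_Integration.integral_cnj[symmetric])
  then show ?thesis by (simp add: cis_cnj)
qed

lemma integrable_Gaussian:
  assumes "0 < c"
  shows "integrable lborel (\<lambda>\<xi>::real. exp (- (c * \<xi>)\<^sup>2 / 2))"
proof -
  have "integrable lborel (\<lambda>x. sqrt (2 * pi) * std_normal_density x)"
    by (intro integrable_mult_right integrable_normal_density) simp
  then have "integrable lborel (\<lambda>x::real. exp (- x\<^sup>2 / 2))"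
    by (simp add: std_normal_density_def)
  from lborel_integrable_real_affine[OF this, of c 0] assms show ?thesis by simp
qed

lemma integral_std_normal_distribution:
  fixes g :: "real \<Rightarrow> complex"
  assumes [measurable]: "g \<in> borel_measurable borel"
  shows "(LINT v|std_normal_distribution. g v) = (LINT v|lborel. of_real (exp (- v\<^sup>2 / 2) / sqrt (2 * pi)) * g v)"
  by (subst integral_density) (auto simp: std_normal_density_def scaleR_conv_of_real)

text \<open>A rescaling of the characteristic function \<open>exp (- t^2 / 2)\<close> of the
  standard normal distribution.\<close>

lemma Gaussian_fourier:
  assumes "0 < c"
  shows "(LINT \<xi>|lborel. of_real (exp (- (c * \<xi>)\<^sup>2 / 2)) * cis (2 * pi * \<xi> * u)) =
         of_real (sqrt (2 * pi) / c * exp (- (2 * pi * u / c)\<^sup>2 / 2))"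
proof -
  let ?g = "\<lambda>w. of_real (exp (- w\<^sup>2 / 2)) * cis (2 * pi * u / c * w) :: complex"
  have "char std_normal_distribution (2 * pi * u / c) = (LINT v|std_normal_distribution. cis (2 * pi * u / c * v))"
    by (simp add: char_def cis_conv_exp)
  also have "\<dots> = (LINT v|lborel. of_real (1 / sqrt (2 * pi)) * ?g v)"
    by (subst integral_std_normal_distribution) (auto simp: algebra_simps)
  also have "\<dots> = of_real (1 / sqrt (2 * pi)) * (LINT v|lborel. ?g v)"
    by (rule integral_mult_right_zero)
  also have "(LINT v|lborel. ?g v) = c *\<^sub>R (LINT \<xi>|lborel. ?g (c * \<xi>))"
    using lborel_integral_real_affine[of c ?g 0] assms by simp
  finally show ?thesis
    using assms by (simp add: char_std_normal_distribution scaleR_conv_of_real field_simps)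
qed

text \<open>Fubini moves the inversion onto the Gaussian, whose transform is known. What remains is
  the mean of \<open>f\<close> under a normal law centred at \<open>s\<close> with standard
  deviation \<open>c / (2 * pi)\<close>, an approximate identity as \<open>c\<close> tends to
  0.\<close>

lemma Gaussian_fourier_inversion:
  assumes f: "cont_bdd_int f" and c: "0 < c"
  shows "(LINT \<xi>|lborel. fourier f \<xi> * of_real (exp (- (c * \<xi>)\<^sup>2 / 2)) * cis (2 * pi * \<xi> * s)) =
         (LINT v|std_normal_distribution. f (s + c / (2 * pi) * v))"
proof -
  define E :: "real \<Rightarrow> complex" where "E \<xi> = of_real (exp (- (c * \<xi>)\<^sup>2 / 2))" for \<xi>
  have E: "integrable lborel E" unfolding E_def[abs_def] by (intro integrable_of_real integrable_Gaussian c)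
  have fi: "integrable lborel f" using f by (simp add: cont_bdd_int_def)
  have [measurable]: "f \<in> borel_measurable borel" "E \<in> borel_measurable borel"
    using f by (auto intro: cont_bdd_int_measurable simp: E_def[abs_def])
  have int: "integrable (lborel \<Otimes>\<^sub>M lborel) (\<lambda>(t, \<xi>). f t * E \<xi> * cis (2 * pi * \<xi> * (s - t)))"
    using integrable_pair_mult[OF fi E, of "\<lambda>(t, \<xi>). cis (2 * pi * \<xi> * (s - t))"] by auto
  have "(LINT \<xi>|lborel. fourier f \<xi> * E \<xi> * cis (2 * pi * \<xi> * s)) =
        (LINT \<xi>|lborel. LINT t|lborel. f t * E \<xi> * cis (2 * pi * \<xi> * (s - t)))"
  proof (intro Bochner_Integration.integral_cong)
    fix \<xi>
    have "fourier f \<xi> * E \<xi> * cis (2 * pi * \<xi> * s) =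
          (LINT t|lborel. f t * cis (- (2 * pi * \<xi> * t)) * (E \<xi> * cis (2 * pi * \<xi> * s)))"
      by (simp only: fourier_def integral_mult_left_zero mult.assoc[of "integral\<^sup>L _ _"])
    also have "\<dots> = (LINT t|lborel. f t * E \<xi> * cis (2 * pi * \<xi> * (s - t)))"
    proof -
      have *: "cis (2 * pi * \<xi> * (s - t)) = cis (- (2 * pi * \<xi> * t)) * cis (2 * pi * \<xi> * s)" for t
        by (simp add: cis_mult algebra_simps)
      show ?thesis unfolding * by (simp only: mult_ac)
    qed
    finally show "fourier f \<xi> * E \<xi> * cis (2 * pi * \<xi> * s) =
          (LINT t|lborel. f t * E \<xi> * cis (2 * pi * \<xi> * (s - t)))" .
  qed simp
  also have "\<dots> = (LINT t|lborel. LINT \<xi>|lborel. f t * E \<xi> * cis (2 * pi * \<xi> * (s - t)))"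
    using lborel_pair.Fubini_integral[OF int] .
  also have "\<dots> = (LINT t|lborel. f t * of_real (sqrt (2 * pi) / c * exp (- (2 * pi * (s - t) / c)\<^sup>2 / 2)))"
    unfolding E_def mult.assoc[of "f _"] integral_mult_right_zero Gaussian_fourier[OF c] ..
  also have "\<dots> = (c / (2 * pi)) *\<^sub>R (LINT v|lborel. f (s + c / (2 * pi) * v) * of_real (sqrt (2 * pi) / c * exp (- v\<^sup>2 / 2)))"
    using lborel_integral_real_affine[of "c / (2 * pi)" "\<lambda>t. f t * of_real (sqrt (2 * pi) / c * exp (- (2 * pi * (s - t) / c)\<^sup>2 / 2))" s] c
    by simp
  also have "\<dots> = (LINT v|lborel. of_real (exp (- v\<^sup>2 / 2) / sqrt (2 * pi)) * f (s + c / (2 * pi) * v))"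
  proof -
    \<comment> \<open>The Jacobian of \<open>t = s + c / (2 * pi) * v\<close> and the factor from
      \<open>Gaussian_fourier\<close> combine to the normalisation of the normal density.\<close>
    have real: "c / (2 * pi) * (sqrt (2 * pi) / c * x) = x / sqrt (2 * pi)" for x
      using c by (simp add: field_simps flip: power2_eq_square)
    have "complex_of_real (c / (2 * pi)) * (z * of_real (sqrt (2 * pi) / c * x)) =
          of_real (c / (2 * pi) * (sqrt (2 * pi) / c * x)) * z" for x z
      by (simp only: of_real_mult mult_ac)
    then have "complex_of_real (c / (2 * pi)) * (z * of_real (sqrt (2 * pi) / c * x)) =
          of_real (x / sqrt (2 * pi)) * z" for x z
      unfolding real .
    then show ?thesis
      unfolding scaleR_conv_of_real integral_mult_right_zero[symmetric] by simp
  qed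
  also have "\<dots> = (LINT v|std_normal_distribution. f (s + c / (2 * pi) * v))"
    by (subst integral_std_normal_distribution) auto
  finally show ?thesis by (simp add: E_def)
qed

text \<open>The Gaussian factor makes the double integral absolutely convergent;
  \<open>cnj (fourier f \<xi>)\<close> is written out as an integral, the order is exchanged, and
  the regularised inversion evaluates the inner integral.\<close>

lemma Plancherel_Gaussian:
  assumes f: "cont_bdd_int f" and c: "0 < c"
  shows "of_real (LINT \<xi>|lborel. (cmod (fourier f \<xi>))\<^sup>2 * exp (- (c * \<xi>)\<^sup>2 / 2)) =
         (LINT s|lborel. cnj (f s) * (LINT v|std_normal_distribution. f (s + c / (2 * pi) * v)))"
    and "integrable lborel (\<lambda>\<xi>. (cmod (fourier f \<xi>))\<^sup>2 * exp (- (c * \<xi>)\<^sup>2 / 2))"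
proof -
  define E :: "real \<Rightarrow> complex" where "E \<xi> = of_real (exp (- (c * \<xi>)\<^sup>2 / 2))" for \<xi>
  have E: "integrable lborel E" unfolding E_def[abs_def] by (intro integrable_of_real integrable_Gaussian c)
  have fi: "integrable lborel f" using f by (simp add: cont_bdd_int_def)
  have [measurable]: "f \<in> borel_measurable borel" "E \<in> borel_measurable borel"
    using f by (auto intro: cont_bdd_int_measurable simp: E_def[abs_def])
  note [measurable] = fourier_measurable[OF fi]
  define K where "K = (LINT t|lborel. cmod (f t))"
  have K: "0 \<le> K" "\<And>\<xi>. cmod (fourier f \<xi>) \<le> K" using fourier_bound[of f] by (auto simp: K_def)
  have FE: "integrable lborel (\<lambda>\<xi>. fourier f \<xi> * E \<xi>)"
  proof (rule Bochner_Integration.integrable_bound)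
    show "integrable lborel (\<lambda>\<xi>. of_real K * E \<xi>)" using E by simp
    show "AE x in lborel. norm (fourier f x * E x) \<le> norm (of_real K * E x)"
      using K by (auto simp: norm_mult mult_right_mono)
  qed simp
  show "integrable lborel (\<lambda>\<xi>. (cmod (fourier f \<xi>))\<^sup>2 * exp (- (c * \<xi>)\<^sup>2 / 2))"
  proof (rule Bochner_Integration.integrable_bound)
    show "integrable lborel (\<lambda>\<xi>. K\<^sup>2 * exp (- (c * \<xi>)\<^sup>2 / 2))" using integrable_Gaussian[OF c] by simp
    show "AE \<xi> in lborel. norm ((cmod (fourier f \<xi>))\<^sup>2 * exp (- (c * \<xi>)\<^sup>2 / 2)) \<le> norm (K\<^sup>2 * exp (- (c * \<xi>)\<^sup>2 / 2))"
      using K by (auto intro!: mult_right_mono power_mono)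
  qed simp
  have cfi: "integrable lborel (\<lambda>s. cnj (f s))" using fi by simp
  have int: "integrable (lborel \<Otimes>\<^sub>M lborel) (\<lambda>(\<xi>, s). fourier f \<xi> * E \<xi> * cnj (f s) * cis (2 * pi * \<xi> * s))"
    using integrable_pair_mult[OF FE cfi, of "\<lambda>(\<xi>, s). cis (2 * pi * \<xi> * s)"] by auto
  have "of_real (LINT \<xi>|lborel. (cmod (fourier f \<xi>))\<^sup>2 * exp (- (c * \<xi>)\<^sup>2 / 2)) =
        (LINT \<xi>|lborel. (fourier f \<xi> * E \<xi>) * cnj (fourier f \<xi>))"
    unfolding integral_complex_of_real[symmetric]
    by (intro Bochner_Integration.integral_cong)
       (auto simp: E_def complex_norm_square[symmetric] mult_ac simp flip: of_real_power)
  also have "\<dots> = (LINT \<xi>|lborel. LINT s|lborel. fourier f \<xi> * E \<xi> * cnj (f s) * cis (2 * pi * \<xi> * s))"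
    unfolding cnj_fourier integral_mult_right_zero[symmetric] by (simp only: mult.assoc)
  also have "\<dots> = (LINT s|lborel. LINT \<xi>|lborel. fourier f \<xi> * E \<xi> * cnj (f s) * cis (2 * pi * \<xi> * s))"
    using lborel_pair.Fubini_integral[OF int, symmetric] .
  also have "\<dots> = (LINT s|lborel. cnj (f s) * (LINT \<xi>|lborel. fourier f \<xi> * E \<xi> * cis (2 * pi * \<xi> * s)))"
    unfolding integral_mult_right_zero[symmetric]
    by (intro Bochner_Integration.integral_cong refl) (simp_all add: mult_ac)
  finally show "of_real (LINT \<xi>|lborel. (cmod (fourier f \<xi>))\<^sup>2 * exp (- (c * \<xi>)\<^sup>2 / 2)) =
         (LINT s|lborel. cnj (f s) * (LINT v|std_normal_distribution. f (s + c / (2 * pi) * v)))"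
    unfolding E_def Gaussian_fourier_inversion[OF f c] .
qed

text \<open>As the width of the Gaussian grows, the left-hand side of the regularised identity converges
  monotonically, while on the right the Gaussian averages of \<open>f\<close> converge to \<open>f\<close>.\<close>

lemma Plancherel:
  assumes f: "cont_bdd_int f"
  shows "(\<integral>\<^sup>+\<xi>. ennreal ((cmod (fourier f \<xi>))\<^sup>2) \<partial>lborel) = ennreal ((L2_norm f)\<^sup>2)"
proof -
  define c where "c n = 1 / real (Suc n)" for n
  have c: "0 < c n" "c (Suc n) \<le> c n" for n by (auto simp: c_def frac_le)
  have c0: "c \<longlonglongrightarrow> 0" using LIMSEQ_inverse_real_of_nat by (simp add: c_def[abs_def] inverse_eq_divide)
  have fi: "integrable lborel f" using f by (simp add: cont_bdd_int_def)
  have [measurable]: "f \<in> borel_measurable borel" using f by (rule cont_bdd_int_measurable)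
  note [measurable] = fourier_measurable[OF fi]
  obtain C where C: "0 \<le> C" "\<And>x. cmod (f x) \<le> C" using cont_bdd_int_bounded[OF f] by blast
  interpret N: prob_space std_normal_distribution by (rule prob_space_normal_density) simp
  define L where "L n = (LINT \<xi>|lborel. (cmod (fourier f \<xi>))\<^sup>2 * exp (- (c n * \<xi>)\<^sup>2 / 2))" for n
  define G where "G n s = (LINT v|std_normal_distribution. f (s + c n / (2 * pi) * v))" for n s
  have G_lim: "(\<lambda>n. G n s) \<longlonglongrightarrow> f s" for s
  proof -
    have "(\<lambda>n. G n s) \<longlonglongrightarrow> (LINT v|std_normal_distribution. f (s + 0 / (2 * pi) * v))"
      unfolding G_def
    proof (rule integral_dominated_convergence)
      show "integrable std_normal_distribution (\<lambda>v. C)" by simp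
      have "isCont f z" for z using f by (simp add: cont_bdd_int_def continuous_on_eq_continuous_at)
      then show "AE v in std_normal_distribution. (\<lambda>n. f (s + c n / (2 * pi) * v)) \<longlonglongrightarrow> f (s + 0 / (2 * pi) * v)"
        by (intro AE_I2 isCont_tendsto_compose[of _ f] tendsto_intros c0) simp_all
      show "AE v in std_normal_distribution. cmod (f (s + c n / (2 * pi) * v)) \<le> C" for n using C by simp
    qed simp_all
    then show ?thesis using N.prob_space by simp
  qed
  have G_bound: "cmod (G n s) \<le> C" for n s
  proof -
    have "cmod (G n s) \<le> (LINT v|std_normal_distribution. C)"
      unfolding G_def
      by (rule order_trans[OF integral_norm_bound integral_mono']) (use C in auto)
    then show ?thesis using N.prob_space by simp
  qed
  have [measurable]: "G n \<in> borel_measurable borel" for n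
    unfolding G_def[abs_def] by measurable
  have "(\<lambda>n. LINT s|lborel. cnj (f s) * G n s) \<longlonglongrightarrow> (LINT s|lborel. cnj (f s) * f s)"
  proof (rule integral_dominated_convergence)
    show "integrable lborel (\<lambda>s. cmod (f s) * C)" using fi by simp
    show "AE s in lborel. (\<lambda>n. cnj (f s) * G n s) \<longlonglongrightarrow> cnj (f s) * f s"
      by (intro AE_I2 tendsto_intros G_lim)
  qed (use G_bound in \<open>auto simp: norm_mult intro!: AE_I2 mult_left_mono\<close>)
  also have "(LINT s|lborel. cnj (f s) * f s) = of_real ((L2_norm f)\<^sup>2)"
    using L2_inner_self[of f] by (simp add: L2_inner_def mult.commute)
  finally have "(\<lambda>n. complex_of_real (L n)) \<longlonglongrightarrow> of_real ((L2_norm f)\<^sup>2)"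
    unfolding L_def G_def Plancherel_Gaussian(1)[OF f c(1)] .
  then have "(\<lambda>n. ennreal (L n)) \<longlonglongrightarrow> ennreal ((L2_norm f)\<^sup>2)"
    by (intro tendsto_ennrealI) (simp only: tendsto_of_real_iff)
  \<comment> \<open>A second evaluation of the same limit. Monotone convergence of extended values
    is used, because integrability of the squared Fourier transform is itself part of the
    claim.\<close>
  moreover have "(\<lambda>n. ennreal (L n)) \<longlonglongrightarrow> (\<integral>\<^sup>+\<xi>. ennreal ((cmod (fourier f \<xi>))\<^sup>2) \<partial>lborel)"
  proof -
    have L_eq: "ennreal (L n) = (\<integral>\<^sup>+\<xi>. ennreal ((cmod (fourier f \<xi>))\<^sup>2 * exp (- (c n * \<xi>)\<^sup>2 / 2)) \<partial>lborel)" for n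
      unfolding L_def by (intro nn_integral_eq_integral[symmetric] Plancherel_Gaussian(2) f c) auto
    show ?thesis
      unfolding L_eq
    proof (rule nn_integral_LIMSEQ)
      show "incseq (\<lambda>n \<xi>. ennreal ((cmod (fourier f \<xi>))\<^sup>2 * exp (- (c n * \<xi>)\<^sup>2 / 2)))"
      proof (intro incseq_SucI le_funI ennreal_leI mult_left_mono)
        fix n \<xi>
        have "(c (Suc n) * \<xi>)\<^sup>2 \<le> (c n * \<xi>)\<^sup>2"
          unfolding power_mult_distrib using c[of n] c[of "Suc n"]
          by (intro mult_right_mono power_mono) auto
        then show "exp (- (c n * \<xi>)\<^sup>2 / 2) \<le> exp (- (c (Suc n) * \<xi>)\<^sup>2 / 2)" by simp
      qed simp
      show "(\<lambda>n. ennreal ((cmod (fourier f \<xi>))\<^sup>2 * exp (- (c n * \<xi>)\<^sup>2 / 2))) \<longlonglongrightarrow> ennreal ((cmod (fourier f \<xi>))\<^sup>2)" for \<xi>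
      proof (rule tendsto_ennrealI)
        have "(\<lambda>n. (cmod (fourier f \<xi>))\<^sup>2 * exp (- (c n * \<xi>)\<^sup>2 / 2)) \<longlonglongrightarrow> (cmod (fourier f \<xi>))\<^sup>2 * exp (- (0 * \<xi>)\<^sup>2 / 2)"
          by (intro tendsto_intros c0) simp
        then show "(\<lambda>n. (cmod (fourier f \<xi>))\<^sup>2 * exp (- (c n * \<xi>)\<^sup>2 / 2)) \<longlonglongrightarrow> (cmod (fourier f \<xi>))\<^sup>2" by simp
      qed
    qed simp
  qed
  ultimately show ?thesis by (intro LIMSEQ_unique)
qed

section \<open>Convolution and its Fourier transform\<close>

definition conv :: "(real \<Rightarrow> complex) \<Rightarrow> (real \<Rightarrow> complex) \<Rightarrow> real \<Rightarrow> complex" where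
  "conv f g x = (LINT t|lborel. f t * g (x - t))"

lemma integrable_conv_kernel:
  fixes f g :: "real \<Rightarrow> complex"
  assumes f: "integrable lborel f" and g: "integrable lborel g"
  shows "integrable (lborel \<Otimes>\<^sub>M lborel) (\<lambda>(t, x). f t * g (x - t))"
proof (rule lborel_pair.Fubini_integrable)
  have [measurable]: "f \<in> borel_measurable borel" "g \<in> borel_measurable borel"
    using borel_measurable_integrable[OF f] borel_measurable_integrable[OF g] by auto
  show "(\<lambda>(t, x). f t * g (x - t)) \<in> borel_measurable (lborel \<Otimes>\<^sub>M lborel)" by measurable
  have shift: "integrable lborel (\<lambda>x. g (x - t))" for t
    using lborel_integrable_real_affine[OF g, of 1 "- t"] by simp
  then show "AE t in lborel. integrable lborel (\<lambda>x. case (t, x) of (t, x) \<Rightarrow> f t * g (x - t))" by simp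
  have "(LINT x|lborel. cmod (g (x - t))) = (LINT x|lborel. cmod (g x))" for t
    using lborel_integral_real_affine[of 1 "\<lambda>x. cmod (g x)" "- t"] by simp
  then show "integrable lborel (\<lambda>t. LINT x|lborel. cmod (case (t, x) of (t, x) \<Rightarrow> f t * g (x - t)))"
    using f by (simp add: norm_mult)
qed

text \<open>Makes Plancherel applicable to the transform as a function of \<open>x\<close>.
  Boundedness and continuity rest on the majorant \<open>cmod (f t) * C\<close>, integrability on
  Fubini.\<close>

lemma cont_bdd_int_conv:
  assumes f: "cont_bdd_int f" and g: "cont_bdd_int g"
  shows "cont_bdd_int (conv f g)"
proof -
  have fg: "integrable lborel f" "integrable lborel g" using f g by (auto simp: cont_bdd_int_def)
  have [measurable]: "f \<in> borel_measurable borel" "g \<in> borel_measurable borel"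
    using f g by (auto intro: cont_bdd_int_measurable)
  obtain C where C: "0 \<le> C" "\<And>x. cmod (g x) \<le> C" using cont_bdd_int_bounded[OF g] by blast
  have "integrable lborel (conv f g)"
    using lborel_pair.integrable_snd[OF integrable_conv_kernel[OF fg]] by (simp add: conv_def[abs_def])
  moreover have "cmod (conv f g x) \<le> (LINT t|lborel. cmod (f t) * C)" for x
    unfolding conv_def
    by (rule order_trans[OF integral_norm_bound integral_mono'])
       (use fg C in \<open>auto simp: norm_mult intro!: mult_left_mono\<close>)
  then have "bounded (range (conv f g))" by (auto simp: bounded_iff)
  moreover have "isCont (conv f g) x" for x
    unfolding continuous_at_sequentially comp_def conv_def
  proof (intro allI impI)
    fix y assume y: "y \<longlonglongrightarrow> x"
    show "(\<lambda>n. LINT t|lborel. f t * g (y n - t)) \<longlonglongrightarrow> (LINT t|lborel. f t * g (x - t))"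
    proof (rule integral_dominated_convergence)
      show "integrable lborel (\<lambda>t. cmod (f t) * C)" using fg by simp
      have "isCont g z" for z using g by (simp add: cont_bdd_int_def continuous_on_eq_continuous_at)
      then show "AE t in lborel. (\<lambda>n. f t * g (y n - t)) \<longlonglongrightarrow> f t * g (x - t)"
        using y by (auto intro!: tendsto_intros isCont_tendsto_compose[of _ g])
    qed (use C in \<open>auto simp: norm_mult intro!: AE_I2 mult_left_mono\<close>)
  qed
  ultimately show ?thesis
    by (simp add: cont_bdd_int_def continuous_at_imp_continuous_on)
qed

lemma fourier_conv:
  assumes f: "integrable lborel f" and g: "integrable lborel g"
  shows "fourier (conv f g) \<xi> = fourier f \<xi> * fourier g \<xi>"
proof -
  let ?e = "\<lambda>t. cis (- (2 * pi * \<xi> * t))"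
  have [measurable]: "f \<in> borel_measurable borel" "g \<in> borel_measurable borel"
    using borel_measurable_integrable[OF f] borel_measurable_integrable[OF g] by auto
  have "integrable (lborel \<Otimes>\<^sub>M lborel) (\<lambda>z. (case z of (t, x) \<Rightarrow> f t * g (x - t)) * ?e (snd z))"
    by (intro integrable_mult_unimodular integrable_conv_kernel f g) auto
  then have int: "integrable (lborel \<Otimes>\<^sub>M lborel) (\<lambda>(t, x). f t * g (x - t) * ?e x)"
    by (simp add: case_prod_unfold)
  have "fourier (conv f g) \<xi> = (LINT x|lborel. LINT t|lborel. f t * g (x - t) * ?e x)"
    by (simp add: fourier_def conv_def)
  also have "\<dots> = (LINT t|lborel. LINT x|lborel. f t * g (x - t) * ?e x)"
    using lborel_pair.Fubini_integral[OF int] .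
  also have "\<dots> = (LINT t|lborel. f t * ?e t * fourier g \<xi>)"
  proof (rule Bochner_Integration.integral_cong)
    fix t
    have "(LINT x|lborel. f t * g (x - t) * ?e x) = (LINT x|lborel. f t * g x * ?e (x + t))"
      using lborel_integral_real_affine[of 1 "\<lambda>x. f t * g x * ?e (x + t)" "- t"] by simp
    also have "\<dots> = (LINT x|lborel. (f t * ?e t) * (g x * ?e x))"
      by (intro Bochner_Integration.integral_cong) (auto simp: cis_mult algebra_simps)
    finally show "(LINT x|lborel. f t * g (x - t) * ?e x) = f t * ?e t * fourier g \<xi>"
      by (simp add: fourier_def)
  qed simp
  finally show ?thesis by (simp add: fourier_def)
qed

section \<open>Density in \<open>L\<^sup>2\<close>\<close>

lemma L2_norm_triangle:
  assumes "f \<in> L2" "g \<in> L2"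
  shows "L2_norm (\<lambda>t. f t + g t) \<le> L2_norm f + L2_norm g"
proof -
  interpret coercive_form L2_inner 1 1 by (rule coercive_form_L2_inner)
  let ?s = "\<lambda>t. f t + g t"
  have "L2_inner ?s ?s = L2_inner f f + L2_inner g g + (L2_inner f g + cnj (L2_inner f g))"
    using assms by (simp add: add_left add_right L2_add L2_inner_commute[of g f])
  then have "(L2_norm ?s)\<^sup>2 = (L2_norm f)\<^sup>2 + (L2_norm g)\<^sup>2 + 2 * Re (L2_inner f g)"
    unfolding L2_inner_self by (simp add: complex_eq_iff)
  also have "\<dots> \<le> (L2_norm f)\<^sup>2 + (L2_norm g)\<^sup>2 + 2 * (L2_norm f * L2_norm g)"
    using complex_Re_le_cmod[of "L2_inner f g"] L2_inner_bound[OF assms] by linarith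
  also have "\<dots> = (L2_norm f + L2_norm g)\<^sup>2" by (simp add: power2_sum)
  finally show ?thesis by (rule power2_le_imp_le) simp
qed

lemma L2_norm_minus_commute: "L2_norm (\<lambda>t. f t - g t) = L2_norm (\<lambda>t. g t - f t)"
  by (simp add: L2_norm_def norm_minus_commute)

lemma L2_norm_tendsto_0:
  assumes [measurable]: "\<And>n. s n \<in> borel_measurable borel" and w: "integrable lborel w"
    and lim: "AE t in lborel. (\<lambda>n. s n t) \<longlonglongrightarrow> 0" and bound: "\<And>n t. (cmod (s n t))\<^sup>2 \<le> w t"
  shows "(\<lambda>n. L2_norm (s n)) \<longlonglongrightarrow> 0"
proof -
  have "(\<lambda>n. LINT t|lborel. (cmod (s n t))\<^sup>2) \<longlonglongrightarrow> (LINT t|(lborel :: real measure). (0::real))"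
  proof (rule integral_dominated_convergence[OF _ _ w])
    show "AE t in lborel. (\<lambda>n. (cmod (s n t))\<^sup>2) \<longlonglongrightarrow> 0"
      using lim
    proof eventually_elim
      case (elim t)
      from tendsto_power[OF tendsto_norm[OF this], of 2] show ?case by simp
    qed
  qed (use bound in auto)
  from tendsto_real_sqrt[OF this] show ?thesis by (simp add: L2_norm_def)
qed

text \<open>The radial projection onto the closed disc of radius \<open>r\<close>; written with
  \<open>max\<close> it is visibly continuous.\<close>

definition norm_clamp :: "real \<Rightarrow> complex \<Rightarrow> complex" where
  "norm_clamp r z = of_real (r / max r (cmod z)) * z"

lemma norm_clamp_bound: "0 < r \<Longrightarrow> cmod (norm_clamp r z) \<le> r"
  by (auto simp: norm_clamp_def norm_mult norm_divide max_def divide_simps mult_left_mono)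

lemma norm_clamp_id: "0 < r \<Longrightarrow> cmod z \<le> r \<Longrightarrow> norm_clamp r z = z"
  by (simp add: norm_clamp_def max_def)

lemma continuous_on_norm_clamp [continuous_intros]:
  "0 < r \<Longrightarrow> continuous_on S g \<Longrightarrow> continuous_on S (\<lambda>x. norm_clamp r (g x))"
  unfolding norm_clamp_def by (intro continuous_intros) auto

text \<open>Measurability supplies continuous functions converging to \<open>f\<close> almost
  everywhere, but without a majorant. Clamping the values and cutting off the support creates one,
  and leaves the limit unchanged because \<open>f\<close> already obeys both restrictions.\<close>

lemma cont_bdd_int_dense_bounded:
  fixes f :: "real \<Rightarrow> complex"
  assumes [measurable]: "f \<in> borel_measurable borel" and r: "0 < r"
    and bound: "\<And>t. cmod (f t) \<le> r" and supp: "\<And>t. r < \<bar>t\<bar> \<Longrightarrow> f t = 0" and "0 < \<epsilon>"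
  shows "\<exists>h. cont_bdd_int h \<and> L2_norm (\<lambda>t. f t - h t) < \<epsilon>"
proof -
  have "f measurable_on UNIV"
    by (intro lebesgue_measurable_imp_measurable_on measurable_completion) auto
  then obtain N g where N: "negligible N" and g: "\<And>n. continuous_on UNIV (g n)"
    "\<And>x. x \<notin> N \<Longrightarrow> (\<lambda>n. g n x) \<longlonglongrightarrow> f x"
    by (auto simp: measurable_on_def)
  have AE_N: "AE x in lborel. (x::real) \<notin> N"
    using N AE_not_in[of N lebesgue] by (simp add: negligible_iff_null_sets AE_completion_iff)
  \<comment> \<open>A trapezoid: 1 on \<open>[-r, r]\<close> and 0 outside
    \<open>[-(r + 1), r + 1]\<close>.\<close>
  define \<tau> where "\<tau> t = max 0 (min 1 (r + 1 - \<bar>t\<bar>))" for t :: real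
  have \<tau>: "0 \<le> \<tau> t" "\<tau> t \<le> indicator {- (r + 1)..r + 1} t" "\<bar>t\<bar> \<le> r \<Longrightarrow> \<tau> t = 1" for t
    by (auto simp: \<tau>_def indicator_def)
  define h where "h n t = of_real (\<tau> t) * norm_clamp r (g n t)" for n t
  have h_cont: "continuous_on UNIV (h n)" for n
    unfolding h_def \<tau>_def by (intro continuous_intros r g)
  then have [measurable]: "h n \<in> borel_measurable borel" for n by (rule borel_measurable_continuous_onI)
  have h_bound: "cmod (h n t) \<le> r * indicator {- (r + 1)..r + 1} t" for n t
    using mult_mono[OF \<tau>(2)[of t] norm_clamp_bound[OF r, of "g n t"]] \<tau>(1)[of t] r
    by (simp add: h_def norm_mult mult.commute)
  have ind: "integrable lborel (\<lambda>t::real. indicator {- (r + 1)..r + 1} t :: real)"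
    by (intro integrable_real_indicator) (auto simp: emeasure_lborel_Icc_eq)
  have "cont_bdd_int (h n)" for n
    unfolding cont_bdd_int_def
  proof (intro conjI h_cont)
    have "r * indicator {- (r + 1)..r + 1} t \<le> r" for t
      using r by (simp add: indicator_def)
    then have "cmod (h n t) \<le> r" for t
      using h_bound[of n t] order_trans by blast
    then show "bounded (range (h n))" by (intro boundedI[of _ r]) auto
    show "integrable lborel (h n)"
      by (rule Bochner_Integration.integrable_bound[OF integrable_mult_right[OF ind, of r]])
         (use h_bound r in auto)
  qed
  moreover have "(\<lambda>n. L2_norm (\<lambda>t. f t - h n t)) \<longlonglongrightarrow> 0"
  proof (rule L2_norm_tendsto_0)
    show "integrable lborel (\<lambda>t. (2 * r)\<^sup>2 * indicator {- (r + 1)..r + 1} t :: real)"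
      using ind by simp
    show "AE t in lborel. (\<lambda>n. f t - h n t) \<longlonglongrightarrow> 0"
      using AE_N
    proof eventually_elim
      case (elim t)
      have "isCont (norm_clamp r) z" for z
        using continuous_on_norm_clamp[OF r continuous_on_id, of UNIV] by (simp add: continuous_on_eq_continuous_at)
      then have "(\<lambda>n. h n t) \<longlonglongrightarrow> of_real (\<tau> t) * norm_clamp r (f t)"
        unfolding h_def using g(2)[OF elim] by (intro tendsto_intros isCont_tendsto_compose[of _ "norm_clamp r"])
      also have "of_real (\<tau> t) * norm_clamp r (f t) = f t"
        using bound[of t] supp[of t] r \<tau>(3)[of t] by (cases "\<bar>t\<bar> \<le> r") (auto simp: norm_clamp_id)
      finally show ?case using tendsto_diff[OF tendsto_const[of "f t"]] by fastforce
    qed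
    show "(cmod (f t - h n t))\<^sup>2 \<le> (2 * r)\<^sup>2 * indicator {- (r + 1)..r + 1} t" for n t
    proof (cases "t \<in> {- (r + 1)..r + 1}")
      case True
      then have "cmod (f t - h n t) \<le> 2 * r"
        using norm_triangle_ineq4[of "f t" "h n t"] bound[of t] h_bound[of n t] by simp
      then have "(cmod (f t - h n t))\<^sup>2 \<le> (2 * r)\<^sup>2" by (intro power_mono) auto
      then show ?thesis using True by simp
    next
      case False
      then have "f t = 0" "h n t = 0" using supp[of t] h_bound[of n t] by (auto simp: abs_if split: if_splits)
      then show ?thesis by simp
    qed
  qed simp
  then have "\<forall>\<^sub>F n in sequentially. L2_norm (\<lambda>t. f t - h n t) < \<epsilon>"
    using \<open>0 < \<epsilon>\<close> by (rule order_tendstoD)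
  then obtain n where "L2_norm (\<lambda>t. f t - h n t) < \<epsilon>" by (auto simp: eventually_sequentially)
  ultimately show ?thesis by blast
qed

lemma cont_bdd_int_dense:
  assumes f: "f \<in> L2" and "0 < \<epsilon>"
  shows "\<exists>h. cont_bdd_int h \<and> L2_norm (\<lambda>t. f t - h t) < \<epsilon>"
proof -
  have [measurable]: "f \<in> borel_measurable borel" using f by (rule L2_measurable)
  \<comment> \<open>Truncation in both argument and value. \<open>Suc n\<close> keeps the radius
    positive, as the bounded case requires.\<close>
  define k where "k n t = (if \<bar>t\<bar> \<le> real (Suc n) \<and> cmod (f t) \<le> real (Suc n) then f t else 0)" for n t
  have [measurable]: "k n \<in> borel_measurable borel" for n unfolding k_def[abs_def] by measurable
  have k_bound: "cmod (k n t) \<le> cmod (f t)" "(cmod (f t - k n t))\<^sup>2 \<le> (cmod (f t))\<^sup>2" for n t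
    by (auto simp: k_def)
  have int: "integrable lborel (\<lambda>t. (cmod (f t))\<^sup>2)" using f by (simp add: L2_def)
  have k_L2: "k n \<in> L2" for n
    using Bochner_Integration.integrable_bound[OF int, of "\<lambda>t. (cmod (k n t))\<^sup>2"] k_bound
    by (simp add: L2_def power_mono)
  have "(\<lambda>n. L2_norm (\<lambda>t. f t - k n t)) \<longlonglongrightarrow> 0"
  proof (rule L2_norm_tendsto_0[OF _ int])
    have "(\<lambda>n. f t - k n t) \<longlonglongrightarrow> 0" for t
    proof (rule tendsto_eventually)
      obtain m where m: "max \<bar>t\<bar> (cmod (f t)) \<le> real m" using real_arch_simple by blast
      show "\<forall>\<^sub>F n in sequentially. f t - k n t = 0"
        using eventually_ge_at_top[of m]
      proof eventually_elim
        case (elim n)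
        then have "real m \<le> real (Suc n)" by simp
        with m show ?case by (simp add: k_def)
      qed
    qed
    then show "AE t in lborel. (\<lambda>n. f t - k n t) \<longlonglongrightarrow> 0" by simp
  qed (use k_bound in auto)
  then have "\<forall>\<^sub>F n in sequentially. L2_norm (\<lambda>t. f t - k n t) < \<epsilon> / 2"
    using \<open>0 < \<epsilon>\<close> by (intro order_tendstoD) auto
  then obtain n where n: "L2_norm (\<lambda>t. f t - k n t) < \<epsilon> / 2" by (auto simp: eventually_sequentially)
  have "\<exists>h. cont_bdd_int h \<and> L2_norm (\<lambda>t. k n t - h t) < \<epsilon> / 2"
  proof (rule cont_bdd_int_dense_bounded)
    show "cmod (k n t) \<le> real (Suc n)" "real (Suc n) < \<bar>t\<bar> \<Longrightarrow> k n t = 0" for t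
      by (auto simp: k_def)
  qed (use \<open>0 < \<epsilon>\<close> in auto)
  then obtain h where h: "cont_bdd_int h" "L2_norm (\<lambda>t. k n t - h t) < \<epsilon> / 2" by blast
  have "L2_norm (\<lambda>t. f t - h t) = L2_norm (\<lambda>t. (f t - k n t) + (k n t - h t))" by simp
  also have "\<dots> \<le> L2_norm (\<lambda>t. f t - k n t) + L2_norm (\<lambda>t. k n t - h t)"
    by (intro L2_norm_triangle L2_diff f k_L2 cont_bdd_int_L2 h)
  finally show ?thesis using n h by (intro exI[of _ h]) auto
qed

lemma cont_bdd_int_dense_sequence:
  assumes f: "f \<in> L2"
  obtains h where "\<And>n. cont_bdd_int (h n)" "(\<lambda>n. L2_norm (\<lambda>t. f t - h n t)) \<longlonglongrightarrow> 0"
proof -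
  have "\<exists>h. cont_bdd_int h \<and> L2_norm (\<lambda>t. f t - h t) < 1 / real (Suc n)" for n
    by (intro cont_bdd_int_dense f) simp
  then obtain h where h: "\<And>n. cont_bdd_int (h n)" "\<And>n. L2_norm (\<lambda>t. f t - h n t) < 1 / real (Suc n)"
    by metis
  have "(\<lambda>n. L2_norm (\<lambda>t. f t - h n t)) \<longlonglongrightarrow> 0"
  proof (rule tendsto_sandwich[OF _ _ tendsto_const])
    show "(\<lambda>n. 1 / real (Suc n)) \<longlonglongrightarrow> 0"
      using LIMSEQ_inverse_real_of_nat by (simp add: inverse_eq_divide)
  qed (use h(2) in \<open>auto intro!: always_eventually less_imp_le\<close>)
  with h(1) show thesis by (rule that)
qed

section \<open>The transform and its multiplier\<close>

definition alpha_transform :: "real \<Rightarrow> (real \<Rightarrow> complex) \<Rightarrow> (real \<Rightarrow> complex) \<Rightarrow> real \<times> real \<Rightarrow> complex" where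
  "alpha_transform \<alpha> \<psi> f = (\<lambda>(x, \<omega>). L2_inner f (alpha_atom \<alpha> \<psi> x \<omega>))"

text \<open>The conjugate of the reflected atom at \<open>x = 0\<close>, so that the transform at
  frequency \<omega> is the convolution with this kernel.\<close>

definition alpha_kernel :: "real \<Rightarrow> (real \<Rightarrow> complex) \<Rightarrow> real \<Rightarrow> real \<Rightarrow> complex" where
  "alpha_kernel \<alpha> \<psi> \<omega> s =
     of_real (alpha_scale \<alpha> \<omega> powr (- 1 / 2)) * (cis (2 * pi * \<omega> * s) * cnj (\<psi> (- s / alpha_scale \<alpha> \<omega>)))"

text \<open>The multiplier of the operator, taken as an extended nonnegative integral so that it has
  a meaning before any bound on it is known.\<close>

definition alpha_multiplier :: "real \<Rightarrow> (real \<Rightarrow> complex) \<Rightarrow> real \<Rightarrow> ennreal" where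
  "alpha_multiplier \<alpha> \<psi> \<xi> =
     (\<integral>\<^sup>+\<omega>. ennreal (alpha_scale \<alpha> \<omega> * (cmod (fourier \<psi> (alpha_scale \<alpha> \<omega> * (\<xi> - \<omega>))))\<^sup>2) \<partial>lborel)"

lemma alpha_scale_pos: "0 < alpha_scale \<alpha> \<omega>"
  by (simp add: alpha_scale_def add_pos_nonneg)

lemma alpha_scale_measurable [measurable]: "alpha_scale \<alpha> \<in> borel_measurable borel"
  unfolding alpha_scale_def[abs_def] by measurable

lemma cnj_alpha_atom: "cnj (alpha_atom \<alpha> \<psi> x \<omega> t) = alpha_kernel \<alpha> \<psi> \<omega> (x - t)"
proof -
  have "exp (2 * of_real pi * \<i> * of_real \<omega> * of_real (t - x)) = cis (2 * pi * \<omega> * (t - x))"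
    by (simp add: cis_conv_exp mult_ac)
  moreover have "cis (- (2 * pi * \<omega> * (t - x))) = cis (2 * pi * \<omega> * (x - t))" "- (x - t) = t - x"
    by (simp_all add: algebra_simps)
  ultimately show ?thesis
    by (simp add: alpha_atom_def translation_def modulation_def dilation_def alpha_kernel_def cis_cnj
        mult.left_commute del: of_real_diff)
qed

lemma alpha_atom_eq: "alpha_atom \<alpha> \<psi> x \<omega> t = cnj (alpha_kernel \<alpha> \<psi> \<omega> (x - t))"
  by (simp flip: cnj_alpha_atom)

lemma alpha_transform_eq_conv: "alpha_transform \<alpha> \<psi> f (x, \<omega>) = conv f (alpha_kernel \<alpha> \<psi> \<omega>) x"
  by (simp add: alpha_transform_def L2_inner_def conv_def cnj_alpha_atom)

lemma cont_bdd_int_affine: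
  assumes "cont_bdd_int f" "c \<noteq> 0"
  shows "cont_bdd_int (\<lambda>x. f (t + c * x))"
  unfolding cont_bdd_int_def
proof (intro conjI)
  show "continuous_on UNIV (\<lambda>x. f (t + c * x))"
    by (rule continuous_on_compose2[of UNIV f])
       (use assms in \<open>auto simp: cont_bdd_int_def intro!: continuous_intros\<close>)
  have "range (\<lambda>x. f (t + c * x)) \<subseteq> range f" by auto
  then show "bounded (range (\<lambda>x. f (t + c * x)))"
    using assms(1) bounded_subset by (auto simp: cont_bdd_int_def)
  show "integrable lborel (\<lambda>x. f (t + c * x))"
    using assms by (intro lborel_integrable_real_affine) (auto simp: cont_bdd_int_def)
qed

lemma cont_bdd_int_cnj: "cont_bdd_int f \<Longrightarrow> cont_bdd_int (\<lambda>x. cnj (f x))"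
  unfolding cont_bdd_int_def bounded_iff by (auto intro!: continuous_intros)

lemma cont_bdd_int_kernel:
  assumes "cont_bdd_int \<psi>"
  shows "cont_bdd_int (alpha_kernel \<alpha> \<psi> \<omega>)"
proof -
  let ?b = "alpha_scale \<alpha> \<omega>"
  have "cont_bdd_int (\<lambda>s. cnj (\<psi> (0 + (- 1 / ?b) * s)))"
    using alpha_scale_pos[of \<alpha> \<omega>] by (intro cont_bdd_int_cnj cont_bdd_int_affine assms) auto
  then have g: "cont_bdd_int (\<lambda>s. cnj (\<psi> (- s / ?b)))" by simp
  then obtain C where C: "C \<ge> 0" "\<And>s. cmod (cnj (\<psi> (- s / ?b))) \<le> C" using cont_bdd_int_bounded by blast
  show ?thesis
    unfolding cont_bdd_int_def alpha_kernel_def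
  proof (intro conjI)
    show "continuous_on UNIV (\<lambda>s. of_real (?b powr (- 1 / 2)) * (cis (2 * pi * \<omega> * s) * cnj (\<psi> (- s / ?b))))"
      using conjunct1[OF g[unfolded cont_bdd_int_def]]
      by (intro continuous_on_mult[OF continuous_on_const continuous_on_mult] continuous_on_cis continuous_on_id
          continuous_on_const continuous_on_mult[OF continuous_on_const continuous_on_id])
    show "bounded (range (\<lambda>s. of_real (?b powr (- 1 / 2)) * (cis (2 * pi * \<omega> * s) * cnj (\<psi> (- s / ?b)))))"
      using C by (intro boundedI[of _ "?b powr (- 1 / 2) * C"]) (auto simp: norm_mult intro!: mult_left_mono)
    have "integrable lborel (\<lambda>s. cnj (\<psi> (- s / ?b)) * cis (2 * pi * \<omega> * s))"
      using g by (intro integrable_mult_unimodular) (auto simp: cont_bdd_int_def)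
    then show "integrable lborel (\<lambda>s. of_real (?b powr (- 1 / 2)) * (cis (2 * pi * \<omega> * s) * cnj (\<psi> (- s / ?b))))"
      by (simp add: mult.commute)
  qed
qed

text \<open>Substitution \<open>s = - b * v\<close> with
  \<open>b = alpha_scale \<alpha> \<omega>\<close>. The Jacobian \<open>b\<close> times the
  normalisation \<open>b powr (- 1 / 2)\<close> leaves \<open>sqrt b\<close>, whose square is the
  weight in the multiplier.\<close>

lemma fourier_kernel:
  "fourier (alpha_kernel \<alpha> \<psi> \<omega>) \<xi> =
   of_real (sqrt (alpha_scale \<alpha> \<omega>)) * cnj (fourier \<psi> (alpha_scale \<alpha> \<omega> * (\<xi> - \<omega>)))"
proof -
  let ?b = "alpha_scale \<alpha> \<omega>"
  have b: "0 < ?b" by (rule alpha_scale_pos)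
  let ?g = "\<lambda>s. alpha_kernel \<alpha> \<psi> \<omega> s * cis (- (2 * pi * \<xi> * s))"
  have "?g (- ?b * v) = of_real (?b powr (- 1 / 2)) * (cnj (\<psi> v) * cis (2 * pi * (?b * (\<xi> - \<omega>)) * v))" for v
  proof -
    have "cis (2 * pi * \<omega> * (- ?b * v)) * cis (- (2 * pi * \<xi> * (- ?b * v))) = cis (2 * pi * (?b * (\<xi> - \<omega>)) * v)"
      by (simp add: cis_mult algebra_simps)
    moreover have "- (- ?b * v) / ?b = v" using b by simp
    ultimately show ?thesis by (simp only: alpha_kernel_def mult_ac)
  qed
  then have "fourier (alpha_kernel \<alpha> \<psi> \<omega>) \<xi> =
        ?b *\<^sub>R (LINT v|lborel. of_real (?b powr (- 1 / 2)) * (cnj (\<psi> v) * cis (2 * pi * (?b * (\<xi> - \<omega>)) * v)))"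
    using lborel_integral_real_affine[of "- ?b" ?g 0] b by (simp add: fourier_def)
  also have "\<dots> = of_real (?b * ?b powr (- 1 / 2)) * cnj (fourier \<psi> (?b * (\<xi> - \<omega>)))"
    unfolding cnj_fourier integral_mult_right_zero by (simp add: scaleR_conv_of_real)
  also have "?b * ?b powr (- 1 / 2) = sqrt ?b"
  proof -
    have "?b * ?b powr (- 1 / 2) = ?b powr 1 * ?b powr (- 1 / 2)" using b by simp
    also have "\<dots> = ?b powr (1 / 2)" unfolding powr_add[symmetric] by simp
    finally show ?thesis using b by (simp add: powr_half_sqrt)
  qed
  finally show ?thesis .
qed

lemma alpha_atom_L2: "cont_bdd_int \<psi> \<Longrightarrow> alpha_atom \<alpha> \<psi> x \<omega> \<in> L2"
proof -
  assume "cont_bdd_int \<psi>"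
  then have "cont_bdd_int (\<lambda>t. cnj (alpha_kernel \<alpha> \<psi> \<omega> (x + (- 1) * t)))"
    by (intro cont_bdd_int_cnj cont_bdd_int_affine cont_bdd_int_kernel) auto
  then have "cont_bdd_int (alpha_atom \<alpha> \<psi> x \<omega>)" by (simp add: alpha_atom_eq[abs_def])
  then show ?thesis by (rule cont_bdd_int_L2)
qed

lemma alpha_transform_measurable:
  assumes \<psi>: "cont_bdd_int \<psi>" and f: "f \<in> L2"
  shows "alpha_transform \<alpha> \<psi> f \<in> borel_measurable (lborel \<Otimes>\<^sub>M lborel)"
proof -
  have [measurable]: "\<psi> \<in> borel_measurable borel" "f \<in> borel_measurable borel"
    using \<psi> f by (auto intro: cont_bdd_int_measurable L2_measurable)
  have "alpha_transform \<alpha> \<psi> f = (\<lambda>(x, \<omega>). LINT t|lborel. f t * alpha_kernel \<alpha> \<psi> \<omega> (x - t))"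
    by (auto simp: alpha_transform_eq_conv conv_def)
  also have "\<dots> \<in> borel_measurable (lborel \<Otimes>\<^sub>M lborel)"
    unfolding alpha_kernel_def by measurable
  finally show ?thesis .
qed

text \<open>Every exchange is Tonelli for extended nonnegative values, so the identity holds with
  both sides possibly infinite; bounds on the multiplier make them finite afterwards.\<close>

lemma alpha_transform_energy:
  assumes \<psi>: "cont_bdd_int \<psi>" and f: "cont_bdd_int f"
  shows "(\<integral>\<^sup>+z. ennreal ((cmod (alpha_transform \<alpha> \<psi> f z))\<^sup>2) \<partial>(lborel \<Otimes>\<^sub>M lborel)) =
         (\<integral>\<^sup>+\<xi>. ennreal ((cmod (fourier f \<xi>))\<^sup>2) * alpha_multiplier \<alpha> \<psi> \<xi> \<partial>lborel)"
proof -
  let ?k = "alpha_kernel \<alpha> \<psi>" and ?b = "alpha_scale \<alpha>"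
  have int: "integrable lborel f" "integrable lborel \<psi>" "integrable lborel (?k \<omega>)" for \<omega>
    using f \<psi> cont_bdd_int_kernel[OF \<psi>] by (auto simp: cont_bdd_int_def)
  note [measurable] = alpha_transform_measurable[OF \<psi> cont_bdd_int_L2[OF f]]
    fourier_measurable[OF int(1)] fourier_measurable[OF int(2)]
  have "(\<integral>\<^sup>+z. ennreal ((cmod (alpha_transform \<alpha> \<psi> f z))\<^sup>2) \<partial>(lborel \<Otimes>\<^sub>M lborel)) =
        (\<integral>\<^sup>+\<omega>. \<integral>\<^sup>+x. ennreal ((cmod (alpha_transform \<alpha> \<psi> f (x, \<omega>)))\<^sup>2) \<partial>lborel \<partial>lborel)"
    by (rule lborel_pair.nn_integral_snd[symmetric]) simp
  also have "\<dots> = (\<integral>\<^sup>+\<omega>. \<integral>\<^sup>+\<xi>. ennreal ((cmod (fourier f \<xi>))\<^sup>2) *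
        ennreal (?b \<omega> * (cmod (fourier \<psi> (?b \<omega> * (\<xi> - \<omega>))))\<^sup>2) \<partial>lborel \<partial>lborel)"
  proof (rule nn_integral_cong)
    fix \<omega>
    have c: "cont_bdd_int (conv f (?k \<omega>))"
      by (intro cont_bdd_int_conv f cont_bdd_int_kernel \<psi>)
    have "(\<integral>\<^sup>+x. ennreal ((cmod (alpha_transform \<alpha> \<psi> f (x, \<omega>)))\<^sup>2) \<partial>lborel) =
          (\<integral>\<^sup>+x. ennreal ((cmod (fourier (conv f (?k \<omega>)) x))\<^sup>2) \<partial>lborel)"
      unfolding alpha_transform_eq_conv Plancherel[OF c] by (intro nn_integral_L2_norm cont_bdd_int_L2 c)
    also have "\<dots> = (\<integral>\<^sup>+\<xi>. ennreal ((cmod (fourier f \<xi>))\<^sup>2) *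
        ennreal (?b \<omega> * (cmod (fourier \<psi> (?b \<omega> * (\<xi> - \<omega>))))\<^sup>2) \<partial>lborel)"
      unfolding fourier_conv[OF int(1,3)] fourier_kernel
      using less_imp_le[OF alpha_scale_pos[of \<alpha> \<omega>]]
      by (intro nn_integral_cong) (simp add: norm_mult power_mult_distrib ennreal_mult[symmetric])
    finally show "(\<integral>\<^sup>+x. ennreal ((cmod (alpha_transform \<alpha> \<psi> f (x, \<omega>)))\<^sup>2) \<partial>lborel) =
        (\<integral>\<^sup>+\<xi>. ennreal ((cmod (fourier f \<xi>))\<^sup>2) *
        ennreal (?b \<omega> * (cmod (fourier \<psi> (?b \<omega> * (\<xi> - \<omega>))))\<^sup>2) \<partial>lborel)" .
  qed
  also have "\<dots> = (\<integral>\<^sup>+\<xi>. \<integral>\<^sup>+\<omega>. ennreal ((cmod (fourier f \<xi>))\<^sup>2) *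
        ennreal (?b \<omega> * (cmod (fourier \<psi> (?b \<omega> * (\<xi> - \<omega>))))\<^sup>2) \<partial>lborel \<partial>lborel)"
    by (rule lborel_pair.Fubini') measurable
  also have "\<dots> = (\<integral>\<^sup>+\<xi>. ennreal ((cmod (fourier f \<xi>))\<^sup>2) * alpha_multiplier \<alpha> \<psi> \<xi> \<partial>lborel)"
    unfolding alpha_multiplier_def by (intro nn_integral_cong nn_integral_cmult) simp
  finally show ?thesis .
qed

text \<open>\<open>e f f - e h h\<close> is the sum of \<open>e (f - h) f\<close> and
  \<open>e h (f - h)\<close>, and the latter has the same real part as \<open>e (f - h) h\<close>.
  Applied to the inner product and to the energy form alike.\<close>

lemma hermitian_form_perturbation:
  assumes e: "\<And>f g h. f \<in> L2 \<Longrightarrow> g \<in> L2 \<Longrightarrow> h \<in> L2 \<Longrightarrow> e (\<lambda>t. f t - g t) h = e f h - e g h"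
    and herm: "\<And>f g. e g f = cnj (e f g)"
    and bdd: "\<And>f g. f \<in> L2 \<Longrightarrow> g \<in> L2 \<Longrightarrow> cmod (e f g) \<le> K * L2_norm f * L2_norm g"
    and f: "f \<in> L2" and h: "h \<in> L2"
  shows "\<bar>Re (e f f) - Re (e h h)\<bar> \<le> K * L2_norm (\<lambda>t. f t - h t) * (L2_norm f + L2_norm h)"
proof -
  let ?d = "\<lambda>t. f t - h t"
  have d: "?d \<in> L2" by (intro L2_diff f h)
  have "Re (e f f) - Re (e h h) = Re (e ?d f) + Re (e ?d h)"
    using e[OF f h f] e[OF f h h] herm[of f h] by simp
  then have "\<bar>Re (e f f) - Re (e h h)\<bar> \<le> cmod (e ?d f) + cmod (e ?d h)"
    using abs_Re_le_cmod[of "e ?d f"] abs_Re_le_cmod[of "e ?d h"] by linarith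
  also have "\<dots> \<le> K * L2_norm ?d * L2_norm f + K * L2_norm ?d * L2_norm h"
    by (intro add_mono bdd d f h)
  finally show ?thesis by (simp add: distrib_left)
qed

section \<open>Admissibility from two-sided bounds on the multiplier\<close>

locale alpha_frame =
  fixes \<alpha> :: real and \<psi> :: "real \<Rightarrow> complex" and A B :: real
  assumes \<psi>: "cont_bdd_int \<psi>" and A: "0 < A" and AB: "A \<le> B"
    and multiplier_lower: "\<And>\<xi>. ennreal A \<le> alpha_multiplier \<alpha> \<psi> \<xi>"
    and multiplier_upper: "\<And>\<xi>. alpha_multiplier \<alpha> \<psi> \<xi> \<le> ennreal B"
begin

abbreviation "M \<equiv> (lborel \<Otimes>\<^sub>M lborel) :: (real \<times> real) measure"
abbreviation "W \<equiv> alpha_transform \<alpha> \<psi>"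

lemma energy_upper_cont:
  assumes f: "cont_bdd_int f"
  shows "(\<integral>\<^sup>+z. ennreal ((cmod (W f z))\<^sup>2) \<partial>M) \<le> ennreal (B * (L2_norm f)\<^sup>2)"
proof -
  have [measurable]: "fourier f \<in> borel_measurable borel"
    using f by (intro fourier_measurable) (simp add: cont_bdd_int_def)
  have "(\<integral>\<^sup>+z. ennreal ((cmod (W f z))\<^sup>2) \<partial>M) \<le> (\<integral>\<^sup>+\<xi>. ennreal ((cmod (fourier f \<xi>))\<^sup>2) * ennreal B \<partial>lborel)"
    unfolding alpha_transform_energy[OF \<psi> f]
    by (rule nn_integral_mono, rule mult_left_mono[OF multiplier_upper]) simp
  also have "\<dots> = ennreal ((L2_norm f)\<^sup>2) * ennreal B"
    unfolding Plancherel[OF f, symmetric] by (intro nn_integral_multc) measurable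
  finally show ?thesis using A AB by (simp add: ennreal_mult[symmetric] mult.commute)
qed

lemma energy_lower_cont:
  assumes f: "cont_bdd_int f"
  shows "ennreal (A * (L2_norm f)\<^sup>2) \<le> (\<integral>\<^sup>+z. ennreal ((cmod (W f z))\<^sup>2) \<partial>M)"
proof -
  have [measurable]: "fourier f \<in> borel_measurable borel"
    using f by (intro fourier_measurable) (simp add: cont_bdd_int_def)
  have "ennreal (A * (L2_norm f)\<^sup>2) = ennreal ((L2_norm f)\<^sup>2) * ennreal A"
    using A by (simp add: ennreal_mult[symmetric] mult.commute)
  also have "\<dots> = (\<integral>\<^sup>+\<xi>. ennreal ((cmod (fourier f \<xi>))\<^sup>2) * ennreal A \<partial>lborel)"
    unfolding Plancherel[OF f, symmetric] by (intro nn_integral_multc[symmetric]) measurable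
  also have "\<dots> \<le> (\<integral>\<^sup>+z. ennreal ((cmod (W f z))\<^sup>2) \<partial>M)"
    unfolding alpha_transform_energy[OF \<psi> f]
    by (rule nn_integral_mono, rule mult_left_mono[OF multiplier_lower]) simp
  finally show ?thesis .
qed

lemma W_diff: "f \<in> L2 \<Longrightarrow> g \<in> L2 \<Longrightarrow> W (\<lambda>t. f t - g t) z = W f z - W g z"
  by (cases z) (simp add: alpha_transform_def L2_inner_diff_left alpha_atom_L2[OF \<psi>])

lemma W_add: "f \<in> L2 \<Longrightarrow> g \<in> L2 \<Longrightarrow> W (\<lambda>t. f t + g t) z = W f z + W g z"
  by (cases z) (simp add: alpha_transform_def L2_inner_add_left alpha_atom_L2[OF \<psi>])

lemma W_scale: "W (\<lambda>t. c * f t) z = c * W f z"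
  by (cases z) (simp add: alpha_transform_def L2_inner_scale_left)

text \<open>At a fixed point the transform is an inner product with an L2 atom, so convergence in L2
  gives convergence everywhere; this is the input for Fatou.\<close>

lemma W_tendsto:
  assumes f: "f \<in> L2" and h: "\<And>n. h n \<in> L2" and lim: "(\<lambda>n. L2_norm (\<lambda>t. f t - h n t)) \<longlonglongrightarrow> 0"
  shows "(\<lambda>n. W (h n) z) \<longlonglongrightarrow> W f z"
proof -
  obtain x \<omega> where z: "z = (x, \<omega>)" by (cases z)
  let ?a = "alpha_atom \<alpha> \<psi> x \<omega>"
  have "(\<lambda>n. W (\<lambda>t. f t - h n t) z) \<longlonglongrightarrow> 0"
  proof (rule tendsto_0_le[where K = "L2_norm ?a", OF lim])
    show "\<forall>\<^sub>F n in sequentially. norm (W (\<lambda>t. f t - h n t) z) \<le> norm (L2_norm (\<lambda>t. f t - h n t)) * L2_norm ?a"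
      using L2_inner_bound[OF L2_diff[OF f h] alpha_atom_L2[OF \<psi>]] by (simp add: z alpha_transform_def)
  qed
  then have "(\<lambda>n. W f z - W (h n) z) \<longlonglongrightarrow> 0" by (simp add: W_diff f h)
  from tendsto_diff[OF tendsto_const[of "W f z"] this] show ?thesis by simp
qed

lemma energy_upper:
  assumes f: "f \<in> L2"
  shows "(\<integral>\<^sup>+z. ennreal ((cmod (W f z))\<^sup>2) \<partial>M) \<le> ennreal (B * (L2_norm f)\<^sup>2)"
proof -
  obtain h where h: "\<And>n. cont_bdd_int (h n)" and lim: "(\<lambda>n. L2_norm (\<lambda>t. f t - h n t)) \<longlonglongrightarrow> 0"
    by (rule cont_bdd_int_dense_sequence[OF f]) (rule that)
  have h2: "h n \<in> L2" for n by (intro cont_bdd_int_L2 h)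
  note [measurable] = alpha_transform_measurable[OF \<psi> h2, of \<alpha>]
  define d where "d n = L2_norm (\<lambda>t. f t - h n t)" for n
  have hn: "L2_norm (h n) \<le> L2_norm f + d n" for n
  proof -
    have "L2_norm (h n) = L2_norm (\<lambda>t. f t + (h n t - f t))" by simp
    also have "\<dots> \<le> L2_norm f + L2_norm (\<lambda>t. h n t - f t)" by (intro L2_norm_triangle L2_diff f h2)
    finally show ?thesis by (simp add: d_def L2_norm_minus_commute)
  qed
  have "(\<integral>\<^sup>+z. ennreal ((cmod (W f z))\<^sup>2) \<partial>M) = (\<integral>\<^sup>+z. liminf (\<lambda>n. ennreal ((cmod (W (h n) z))\<^sup>2)) \<partial>M)"
  proof (rule nn_integral_cong)
    fix z
    have "(\<lambda>n. ennreal ((cmod (W (h n) z))\<^sup>2)) \<longlonglongrightarrow> ennreal ((cmod (W f z))\<^sup>2)"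
      by (intro tendsto_ennrealI tendsto_intros W_tendsto f h2 lim)
    then show "ennreal ((cmod (W f z))\<^sup>2) = liminf (\<lambda>n. ennreal ((cmod (W (h n) z))\<^sup>2))"
      by (intro lim_imp_Liminf[symmetric]) auto
  qed
  also have "\<dots> \<le> liminf (\<lambda>n. \<integral>\<^sup>+z. ennreal ((cmod (W (h n) z))\<^sup>2) \<partial>M)"
    by (intro nn_integral_liminf) auto
  also have "\<dots> \<le> liminf (\<lambda>n. ennreal (B * (L2_norm f + d n)\<^sup>2))"
  proof (intro Liminf_mono always_eventually allI)
    fix n
    have "(\<integral>\<^sup>+z. ennreal ((cmod (W (h n) z))\<^sup>2) \<partial>M) \<le> ennreal (B * (L2_norm (h n))\<^sup>2)"
      by (intro energy_upper_cont h)
    also have "\<dots> \<le> ennreal (B * (L2_norm f + d n)\<^sup>2)"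
      using A AB hn by (intro ennreal_leI mult_left_mono power_mono) auto
    finally show "(\<integral>\<^sup>+z. ennreal ((cmod (W (h n) z))\<^sup>2) \<partial>M) \<le> ennreal (B * (L2_norm f + d n)\<^sup>2)" .
  qed
  also have "\<dots> = ennreal (B * (L2_norm f + 0)\<^sup>2)"
    using lim by (intro lim_imp_Liminf tendsto_ennrealI tendsto_intros) (auto simp: d_def)
  finally show ?thesis by simp
qed

lemma W_sq_integrable:
  assumes f: "f \<in> L2"
  shows "sq_integrable M (W f)" and "(LINT z|M. (cmod (W f z))\<^sup>2) \<le> B * (L2_norm f)\<^sup>2"
proof -
  note [measurable] = alpha_transform_measurable[OF \<psi> f, of \<alpha>]
  have int: "integrable M (\<lambda>z. (cmod (W f z))\<^sup>2)"
    using order_le_less_trans[OF energy_upper[OF f]] by (intro integrableI_bounded) auto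
  then show "sq_integrable M (W f)" by (simp add: sq_integrable_def)
  have "ennreal (LINT z|M. (cmod (W f z))\<^sup>2) \<le> ennreal (B * (L2_norm f)\<^sup>2)"
    using energy_upper[OF f] by (subst nn_integral_eq_integral[symmetric]) (use int in auto)
  then show "(LINT z|M. (cmod (W f z))\<^sup>2) \<le> B * (L2_norm f)\<^sup>2"
    using A AB by simp
qed

definition form :: "(real \<Rightarrow> complex) \<Rightarrow> (real \<Rightarrow> complex) \<Rightarrow> complex" where
  "form f g = (LINT z|M. W f z * cnj (W g z))"

lemma form_integrable: "f \<in> L2 \<Longrightarrow> g \<in> L2 \<Longrightarrow> integrable M (\<lambda>z. W f z * cnj (W g z))"
  by (intro sq_integrable_prod W_sq_integrable)

lemma form_hermitian: "form g f = cnj (form f g)"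
proof -
  have "cnj (form f g) = (LINT z|M. cnj (W f z * cnj (W g z)))"
    unfolding form_def by (rule Bochner_Integration.integral_cnj[symmetric])
  then show ?thesis by (simp add: form_def mult.commute)
qed

lemma form_add_left:
  "f \<in> L2 \<Longrightarrow> g \<in> L2 \<Longrightarrow> h \<in> L2 \<Longrightarrow> form (\<lambda>t. f t + g t) h = form f h + form g h"
  by (simp add: form_def W_add distrib_right form_integrable)

lemma form_diff_left:
  "f \<in> L2 \<Longrightarrow> g \<in> L2 \<Longrightarrow> h \<in> L2 \<Longrightarrow> form (\<lambda>t. f t - g t) h = form f h - form g h"
  by (simp add: form_def W_diff left_diff_distrib form_integrable)

lemma form_scale_left: "form (\<lambda>t. c * f t) h = c * form f h"
  by (simp add: form_def W_scale mult.assoc)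

lemma form_bounded:
  assumes "f \<in> L2" "g \<in> L2"
  shows "cmod (form f g) \<le> B * L2_norm f * L2_norm g"
proof -
  have "cmod (form f g) \<le> sqrt (LINT z|M. (cmod (W f z))\<^sup>2) * sqrt (LINT z|M. (cmod (W g z))\<^sup>2)"
    unfolding form_def by (intro Cauchy_Schwarz_integral_cnj W_sq_integrable assms)
  also have "\<dots> \<le> sqrt (B * (L2_norm f)\<^sup>2) * sqrt (B * (L2_norm g)\<^sup>2)"
    by (intro mult_mono real_sqrt_le_mono W_sq_integrable assms) (use A AB in auto)
  also have "\<dots> = B * L2_norm f * L2_norm g"
    using A AB by (simp add: real_sqrt_mult)
  finally show ?thesis .
qed

lemma form_lower_cont:
  assumes f: "cont_bdd_int f"
  shows "A * (L2_norm f)\<^sup>2 \<le> Re (form f f)"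
proof -
  have sq: "sq_integrable M (W f)" by (intro W_sq_integrable cont_bdd_int_L2 f)
  have "ennreal (A * (L2_norm f)\<^sup>2) \<le> ennreal (LINT z|M. (cmod (W f z))\<^sup>2)"
    using energy_lower_cont[OF f] by (subst nn_integral_eq_integral[symmetric]) (use sq in \<open>auto simp: sq_integrable_def\<close>)
  then have "A * (L2_norm f)\<^sup>2 \<le> (LINT z|M. (cmod (W f z))\<^sup>2)"
    by (subst (asm) ennreal_le_iff) auto
  also have "\<dots> = Re (form f f)"
    unfolding form_def complex_norm_square[symmetric] by (simp flip: of_real_power)
  finally show ?thesis .
qed

text \<open>Fatou points the wrong way for a lower bound. Instead both sides are continuous in
  \<open>f\<close>: \<open>form_bounded\<close> and Cauchy-Schwarz bound the change from
  \<open>f\<close> to \<open>h n\<close> by multiples of \<open>E n\<close>, which tends to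
  0.\<close>

lemma form_coercive:
  assumes f: "f \<in> L2"
  shows "A * (L2_norm f)\<^sup>2 \<le> Re (form f f)"
proof -
  obtain h where h: "\<And>n. cont_bdd_int (h n)" and lim: "(\<lambda>n. L2_norm (\<lambda>t. f t - h n t)) \<longlonglongrightarrow> 0"
    by (rule cont_bdd_int_dense_sequence[OF f]) (rule that)
  have h2: "h n \<in> L2" for n by (intro cont_bdd_int_L2 h)
  define d where "d n = L2_norm (\<lambda>t. f t - h n t)" for n
  have hn: "L2_norm (h n) \<le> L2_norm f + d n" for n
  proof -
    have "L2_norm (h n) = L2_norm (\<lambda>t. f t + (h n t - f t))" by simp
    also have "\<dots> \<le> L2_norm f + L2_norm (\<lambda>t. h n t - f t)" by (intro L2_norm_triangle L2_diff f h2)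
    finally show ?thesis by (simp add: d_def L2_norm_minus_commute)
  qed
  have d_nonneg: "0 \<le> d n" for n by (simp add: d_def)
  define E where "E n = d n * (2 * L2_norm f + d n)" for n
  have E: "d n * (L2_norm f + L2_norm (h n)) \<le> E n" for n
    unfolding E_def using hn[of n] d_nonneg[of n] by (intro mult_left_mono) auto
  have "A * (L2_norm f)\<^sup>2 \<le> Re (form f f) + B * E n + A * E n" for n
  proof -
    have "\<bar>Re (L2_inner f f) - Re (L2_inner (h n) (h n))\<bar> \<le> 1 * d n * (L2_norm f + L2_norm (h n))"
      unfolding d_def
      by (rule hermitian_form_perturbation[OF _ _ _ f h2]) (simp_all add: L2_inner_diff_left L2_inner_bound, rule L2_inner_commute)
    then have "(L2_norm f)\<^sup>2 - (L2_norm (h n))\<^sup>2 \<le> E n"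
      using E[of n] by (simp add: L2_inner_self)
    then have "A * (L2_norm f)\<^sup>2 \<le> A * (L2_norm (h n))\<^sup>2 + A * E n"
      using mult_left_mono[of _ _ A] A by (fastforce simp: algebra_simps)
    moreover have "\<bar>Re (form f f) - Re (form (h n) (h n))\<bar> \<le> B * d n * (L2_norm f + L2_norm (h n))"
      unfolding d_def
      by (rule hermitian_form_perturbation[OF form_diff_left form_hermitian form_bounded f h2])
    moreover have "B * (d n * (L2_norm f + L2_norm (h n))) \<le> B * E n"
      using E[of n] A AB by (intro mult_left_mono) auto
    moreover have "A * (L2_norm (h n))\<^sup>2 \<le> Re (form (h n) (h n))" by (intro form_lower_cont h)
    ultimately show ?thesis by (simp add: mult.assoc)
  qed
  moreover have "(\<lambda>n. Re (form f f) + B * E n + A * E n) \<longlonglongrightarrow>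
      Re (form f f) + B * (0 * (2 * L2_norm f + 0)) + A * (0 * (2 * L2_norm f + 0))"
    unfolding E_def d_def by (intro tendsto_intros lim)
  ultimately show ?thesis
    using LIMSEQ_le_const[of _ "Re (form f f)" "A * (L2_norm f)\<^sup>2"] by simp
qed

lemma coercive_form_form: "coercive_form form A B"
  by unfold_locales
    (simp_all add: form_add_left form_scale_left form_hermitian[symmetric] form_bounded form_coercive A)

lemma admissible: "alpha_admissible \<alpha> \<psi>"
proof -
  obtain T where T: "L2_bounded_operator T" "L2_boundedly_invertible T"
    "\<And>f g. f \<in> L2 \<Longrightarrow> g \<in> L2 \<Longrightarrow> L2_inner (T f) g = form f g"
    by (rule form_operator_invertible[OF coercive_form_form]) (rule that)
  have eq: "(\<lambda>(x, \<omega>). L2_inner f (alpha_atom \<alpha> \<psi> x \<omega>) * L2_inner (alpha_atom \<alpha> \<psi> x \<omega>) g) =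
            (\<lambda>z. W f z * cnj (W g z))" for f g
    unfolding L2_inner_commute[of "alpha_atom _ _ _ _" g]
    by (simp add: alpha_transform_def case_prod_unfold)
  have "is_weak_alpha_operator \<alpha> \<psi> T"
    unfolding is_weak_alpha_operator_def eq
    using T(3) form_integrable by (simp add: form_def)
  \<comment> \<open>If \<psi> vanished almost everywhere, its Fourier transform and hence the
    multiplier would be 0, against the lower bound.\<close>
  moreover have "\<not> L2_eq \<psi> (\<lambda>_. 0)"
  proof
    assume "L2_eq \<psi> (\<lambda>_. 0)"
    then have "AE t in lborel. \<psi> t = 0" by (simp add: L2_eq_def)
    then have "fourier \<psi> \<xi> = 0" for \<xi>
      using cont_bdd_int_measurable[OF \<psi>]
      unfolding fourier_def by (intro integral_eq_zero_AE) auto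
    then have "alpha_multiplier \<alpha> \<psi> 0 = 0" by (simp add: alpha_multiplier_def)
    with multiplier_lower[of 0] A show False by simp
  qed
  ultimately show ?thesis
    using T cont_bdd_int_L2[OF \<psi>] unfolding alpha_admissible_def by blast
qed

end

section \<open>Bounds for the multiplier\<close>

text \<open>Comparable frequencies have comparable scales. The natural factor
  \<open>k powr (- \<alpha>)\<close> is at most \<open>1 / k\<close> because
  \<open>k \<le> 1\<close> and \<open>\<alpha> \<le> 1\<close>, which makes the constant independent
  of \<alpha>.\<close>

lemma alpha_scale_le:
  assumes "0 \<le> \<alpha>" "\<alpha> \<le> 1" "0 < k" "k \<le> 1" "k * (1 + \<bar>u\<bar>) \<le> 1 + \<bar>v\<bar>"
  shows "alpha_scale \<alpha> v \<le> alpha_scale \<alpha> u / k"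
proof -
  have "alpha_scale \<alpha> v \<le> (k * (1 + \<bar>u\<bar>)) powr (- \<alpha>)"
    unfolding alpha_scale_def using assms by (intro powr_mono2') (auto intro!: mult_pos_pos add_pos_nonneg)
  also have "\<dots> = k powr (- \<alpha>) * alpha_scale \<alpha> u"
    unfolding alpha_scale_def using assms by (intro powr_mult)
  also have "\<dots> \<le> k powr (- 1) * alpha_scale \<alpha> u"
    using assms by (intro mult_right_mono powr_mono') (auto simp: alpha_scale_def)
  finally show ?thesis using assms by (simp add: powr_minus_divide)
qed

lemma alpha_scale_growth:
  assumes "0 \<le> \<alpha>" "\<alpha> \<le> 1"
  shows "1 / alpha_scale \<alpha> \<omega> \<le> 1 + \<bar>\<omega>\<bar>"
proof -
  have "1 / alpha_scale \<alpha> \<omega> = (1 + \<bar>\<omega>\<bar>) powr \<alpha>"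
    by (simp add: alpha_scale_def powr_minus_divide)
  also have "\<dots> \<le> (1 + \<bar>\<omega>\<bar>) powr 1" using assms by (intro powr_mono) auto
  finally show ?thesis by simp
qed

text \<open>Intermediate value theorem: for \<open>\<alpha> < 1\<close> the numerator outgrows
  \<open>(1 + M) powr \<alpha>\<close>, so the coordinate is at most \<eta> at \<open>M\<close> and
  at least \<eta> at \<open>- M\<close> for large \<open>M\<close>.\<close>

lemma alpha_coordinate_surj:
  assumes "0 \<le> \<alpha>" "\<alpha> < 1"
  obtains \<omega> where "alpha_scale \<alpha> \<omega> * (\<xi> - \<omega>) = \<eta>"
proof -
  let ?u = "\<lambda>\<omega>. alpha_scale \<alpha> \<omega> * (\<xi> - \<omega>)"
  have cont: "isCont ?u \<omega>" for \<omega>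
    unfolding alpha_scale_def by (intro continuous_intros) (auto simp: add_nonneg_eq_0_iff)
  have top: "filterlim (\<lambda>M::real. (M + c) / (1 + M) powr \<alpha>) at_top at_top" for c
    using assms by real_asymp
  have "\<forall>\<^sub>F M in at_top. \<eta> \<le> (M + \<xi>) / (1 + M) powr \<alpha> \<and> - \<eta> \<le> (M + - \<xi>) / (1 + M) powr \<alpha> \<and> 0 \<le> M"
    using top[of \<xi>] top[of "- \<xi>"] by (intro eventually_conj eventually_ge_at_top) (auto simp: filterlim_at_top)
  then obtain M where M: "\<eta> \<le> (M + \<xi>) / (1 + M) powr \<alpha>" "- \<eta> \<le> (M + - \<xi>) / (1 + M) powr \<alpha>" "0 \<le> M"
    by (auto simp: eventually_at_top_linorder)
  have "?u M \<le> \<eta>" "\<eta> \<le> ?u (- M)"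
    using M by (simp_all add: alpha_scale_def powr_minus_divide field_simps)
  with IVT2[of ?u M \<eta> "- M"] cont M(3) that show thesis by auto
qed

lemma alpha_multiplier_lower:
  assumes \<alpha>: "0 \<le> \<alpha>" "\<alpha> < 1" and \<psi>: "cont_bdd_int \<psi>" and nz: "\<psi> \<noteq> (\<lambda>_. 0)"
  obtains A where "0 < A" "\<And>\<xi>. ennreal A \<le> alpha_multiplier \<alpha> \<psi> \<xi>"
proof -
  have \<psi>i: "integrable lborel \<psi>" and \<psi>c: "continuous_on UNIV \<psi>" using \<psi> by (auto simp: cont_bdd_int_def)
  have "\<exists>\<eta>. fourier \<psi> \<eta> \<noteq> 0"
  proof (rule ccontr)
    assume "\<nexists>\<eta>. fourier \<psi> \<eta> \<noteq> 0"
    with Plancherel[OF \<psi>] have "L2_norm \<psi> = 0" by simp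
    then have "AE t in lebesgue. \<psi> t = 0"
      using cont_bdd_int_L2[OF \<psi>] by (simp add: L2_norm_eq_0_iff L2_eq_def AE_completion_iff)
    then obtain N where "N \<in> null_sets lebesgue" "{t. \<psi> t \<noteq> 0} \<subseteq> N"
      by (auto simp: eventually_ae_filter)
    then have "negligible {t. \<psi> t \<noteq> 0}" by (meson negligible_iff_null_sets negligible_subset)
    \<comment> \<open>Continuity turns vanishing almost everywhere into vanishing: a negligible open
      set is empty.\<close>
    moreover have "open {t. \<psi> t \<noteq> 0}" using \<psi>c by (intro open_Collect_neq continuous_on_const)
    ultimately show False using nz open_not_negligible by blast
  qed
  then obtain \<eta> where \<eta>: "fourier \<psi> \<eta> \<noteq> 0" by blast
  define c where "c = cmod (fourier \<psi> \<eta>) / 2"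
  have c: "0 < c" using \<eta> by (simp add: c_def)
  have "isCont (fourier \<psi>) \<eta>" using continuous_fourier[OF \<psi>i] by (simp add: continuous_on_eq_continuous_at)
  then obtain \<delta> where \<delta>: "0 < \<delta>" "\<And>y. \<bar>y - \<eta>\<bar> < \<delta> \<Longrightarrow> cmod (fourier \<psi> y - fourier \<psi> \<eta>) < c"
    using c unfolding continuous_at_eps_delta dist_norm by (metis real_norm_def)
  have large: "c \<le> cmod (fourier \<psi> y)" if "\<bar>y - \<eta>\<bar> < \<delta>" for y
    using \<delta>(2)[OF that] norm_triangle_ineq2[of "fourier \<psi> \<eta>" "fourier \<psi> \<eta> - fourier \<psi> y"]
    by (simp add: c_def norm_minus_commute)
  \<comment> \<open>The bound \<open>1 / 2\<close> keeps the two scales within a factor 2; the other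
    term makes the total displacement \<open>2 * \<epsilon> * (\<bar>\<eta>\<bar> + 1)\<close> at
    most \<open>\<delta> / 2\<close>.\<close>
  define \<epsilon> where "\<epsilon> = min (1 / 2) (\<delta> / (4 * (\<bar>\<eta>\<bar> + 1)))"
  have "0 < \<epsilon>" using \<delta>(1) by (simp add: \<epsilon>_def add_nonneg_pos)
  moreover have "\<epsilon> \<le> 1 / 2" unfolding \<epsilon>_def by (rule min.cobounded1)
  ultimately have \<epsilon>: "0 < \<epsilon>" "\<epsilon> \<le> 1 / 2" .
  have "\<epsilon> \<le> \<delta> / (4 * (\<bar>\<eta>\<bar> + 1))" by (simp add: \<epsilon>_def)
  then have \<epsilon>\<delta>: "4 * \<epsilon> * (\<bar>\<eta>\<bar> + 1) \<le> \<delta>" by (simp add: field_simps)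
  have "ennreal (\<epsilon> * c\<^sup>2) \<le> alpha_multiplier \<alpha> \<psi> \<xi>" for \<xi>
  proof -
    obtain \<omega>\<^sub>0 where \<omega>\<^sub>0: "alpha_scale \<alpha> \<omega>\<^sub>0 * (\<xi> - \<omega>\<^sub>0) = \<eta>"
      by (rule alpha_coordinate_surj[OF \<alpha>])
    define b where "b = alpha_scale \<alpha> \<omega>\<^sub>0"
    have b: "0 < b" by (simp add: b_def alpha_scale_pos)
    let ?I = "{\<omega>\<^sub>0 - \<epsilon> / b..\<omega>\<^sub>0 + \<epsilon> / b}"
    have lower: "b / 2 * c\<^sup>2 \<le> alpha_scale \<alpha> \<omega> * (cmod (fourier \<psi> (alpha_scale \<alpha> \<omega> * (\<xi> - \<omega>))))\<^sup>2"
      if "\<omega> \<in> ?I" for \<omega>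
    proof -
      define \<beta> where "\<beta> = alpha_scale \<alpha> \<omega>"
      have dist: "\<bar>\<omega> - \<omega>\<^sub>0\<bar> \<le> \<epsilon> / b" using that by auto
      \<comment> \<open>As \<open>1 / b\<close> is at most
        \<open>1 + \<bar>\<omega>\<^sub>0\<bar>\<close>, the interval is short relative to its
        centre, which is what the comparison of scales needs.\<close>
      also have "\<dots> \<le> \<epsilon> * (1 + \<bar>\<omega>\<^sub>0\<bar>)"
        using mult_left_mono[OF alpha_scale_growth[of \<alpha> \<omega>\<^sub>0], of \<epsilon>] \<alpha> \<epsilon> by (simp add: b_def)
      finally have dist': "\<bar>\<omega> - \<omega>\<^sub>0\<bar> \<le> \<epsilon> * (1 + \<bar>\<omega>\<^sub>0\<bar>)" .
      \<comment> \<open>\<open>alpha_scale_le\<close> with \<open>k = 1 - \<epsilon>\<close> here,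
        and with \<open>k = 1 / (1 + \<epsilon>)\<close> in the reverse direction below.\<close>
      have "\<beta> \<le> b / (1 - \<epsilon>)"
        unfolding \<beta>_def b_def
        using \<alpha> \<epsilon> dist' by (intro alpha_scale_le) (auto simp: algebra_simps abs_if split: if_splits)
      moreover have "b \<le> \<beta> / (1 / (1 + \<epsilon>))"
        unfolding \<beta>_def b_def
        using \<alpha> \<epsilon> dist' by (intro alpha_scale_le) (auto simp: divide_simps algebra_simps abs_if split: if_splits)
      ultimately have *: "\<beta> * (1 - \<epsilon>) \<le> b" "b \<le> \<beta> * (1 + \<epsilon>)" using \<epsilon> by (simp_all add: field_simps)
      have \<beta>: "0 < \<beta>" by (simp add: \<beta>_def alpha_scale_pos)
      have "\<beta> * \<epsilon> \<le> \<beta> * (1 / 2)" using \<beta> \<epsilon> by (intro mult_left_mono) auto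
      moreover have "\<beta> - \<beta> * \<epsilon> \<le> b" "b \<le> \<beta> + \<beta> * \<epsilon>" using * by (simp_all add: algebra_simps)
      ultimately have \<beta>2: "\<beta> \<le> 2 * b" "b / 2 \<le> \<beta>" using \<beta> by linarith+
      have "\<bar>\<beta> - b\<bar> \<le> \<beta> * \<epsilon>" using * by (auto simp: algebra_simps abs_le_iff)
      also have "\<dots> \<le> 2 * b * \<epsilon>" using \<beta>2 \<epsilon> by (intro mult_right_mono) auto
      finally have diff: "\<bar>\<beta> - b\<bar> * \<bar>\<xi> - \<omega>\<^sub>0\<bar> \<le> 2 * \<epsilon> * \<bar>\<eta>\<bar>"
        using mult_right_mono[of "\<bar>\<beta> - b\<bar>" "2 * b * \<epsilon>" "\<bar>\<xi> - \<omega>\<^sub>0\<bar>"] \<omega>\<^sub>0[symmetric] b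
        by (simp add: abs_mult b_def mult_ac)
      have "\<beta> * \<bar>\<omega> - \<omega>\<^sub>0\<bar> \<le> (2 * b) * (\<epsilon> / b)" using \<beta>2 \<beta> dist b by (intro mult_mono) auto
      then have "\<beta> * \<bar>\<omega> - \<omega>\<^sub>0\<bar> \<le> 2 * \<epsilon>" using b by simp
      \<comment> \<open>\<open>\<xi> - \<omega>\<^sub>0\<close> may be huge, but its modulus is
        \<open>\<bar>\<eta>\<bar> / b\<close>. An error \<open>2 * b * \<epsilon>\<close> in the
        scale therefore moves the coordinate by at most
        \<open>2 * \<epsilon> * \<bar>\<eta>\<bar>\<close>, and the shift of \<omega> by at most
        \<open>2 * \<epsilon>\<close>.\<close>
      moreover have "\<beta> * (\<xi> - \<omega>) - \<eta> = (\<beta> - b) * (\<xi> - \<omega>\<^sub>0) - \<beta> * (\<omega> - \<omega>\<^sub>0)"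
        using \<omega>\<^sub>0 by (simp add: b_def algebra_simps)
      then have "\<bar>\<beta> * (\<xi> - \<omega>) - \<eta>\<bar> \<le> \<bar>\<beta> - b\<bar> * \<bar>\<xi> - \<omega>\<^sub>0\<bar> + \<beta> * \<bar>\<omega> - \<omega>\<^sub>0\<bar>"
        using \<beta> abs_triangle_ineq4[of "(\<beta> - b) * (\<xi> - \<omega>\<^sub>0)" "\<beta> * (\<omega> - \<omega>\<^sub>0)"] by (simp add: abs_mult)
      ultimately have "\<bar>\<beta> * (\<xi> - \<omega>) - \<eta>\<bar> \<le> 2 * \<epsilon> * (\<bar>\<eta>\<bar> + 1)"
        using diff by (simp add: algebra_simps)
      also have "\<dots> < \<delta>" using \<epsilon>\<delta> \<delta>(1) by linarith
      finally have "c \<le> cmod (fourier \<psi> (\<beta> * (\<xi> - \<omega>)))" by (rule large)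
      then show ?thesis
        unfolding \<beta>_def[symmetric] using \<beta>2 b c by (intro mult_mono power_mono) auto
    qed
    \<comment> \<open>Length \<open>2 * \<epsilon> / b\<close> times height
      \<open>b / 2 * c^2\<close>: the scale cancels, so the bound is uniform in \<xi>.\<close>
    have "ennreal (\<epsilon> * c\<^sup>2) = (\<integral>\<^sup>+\<omega>. ennreal (b / 2 * c\<^sup>2) * indicator ?I \<omega> \<partial>lborel)"
      using b \<epsilon> c by (simp add: nn_integral_cmult_indicator ennreal_mult[symmetric] field_simps)
    also have "\<dots> \<le> alpha_multiplier \<alpha> \<psi> \<xi>"
      unfolding alpha_multiplier_def
    proof (rule nn_integral_mono)
      fix \<omega>
      show "ennreal (b / 2 * c\<^sup>2) * indicator ?I \<omega> \<le>
            ennreal (alpha_scale \<alpha> \<omega> * (cmod (fourier \<psi> (alpha_scale \<alpha> \<omega> * (\<xi> - \<omega>))))\<^sup>2)"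
        using lower[of \<omega>] by (cases "\<omega> \<in> ?I") (auto intro!: ennreal_leI)
    qed
    finally show ?thesis .
  qed
  moreover have "0 < \<epsilon> * c\<^sup>2" using \<epsilon> c by simp
  ultimately show thesis by (intro that)
qed

text \<open>Frequencies \<open>\<omega>\<close> at distance at most \<open>(1 + |\<xi>|) / 2\<close> from \<open>\<xi>\<close> have
  \<open>\<beta>(\<omega>)\<close> comparable to \<open>\<beta>(\<xi>)\<close>; for the remaining ones \<open>\<beta>(\<omega>) |\<xi> - \<omega>|\<close> dominates
  \<open>(1 + |\<omega>|) powr (1 - \<alpha>)\<close>, which is why the required decay grows as \<open>\<alpha>\<close> approaches \<open>1\<close>.\<close>

lemma alpha_multiplier_upper:
  assumes \<alpha>: "0 \<le> \<alpha>" "\<alpha> < 1" and n: "1 \<le> real n * (1 - \<alpha>)"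
    and decay: "\<And>\<xi>. (1 + \<bar>\<xi>\<bar>) ^ n * cmod (fourier \<psi> \<xi>) \<le> C"
  obtains B where "\<And>\<xi>. alpha_multiplier \<alpha> \<psi> \<xi> \<le> ennreal B"
proof -
  have C: "0 \<le> C" using decay[of 0] by (simp add: order_trans[OF norm_ge_zero])
  \<comment> \<open>The near frequencies use one power of the decay, so \<open>n = 0\<close> has to
    be excluded.\<close>
  have n1: "1 \<le> n" using n by (cases n) auto
  define P where "P = (\<integral>\<^sup>+x. ennreal (inverse (1 + x\<^sup>2)) \<partial>lborel)"
  have P: "P < \<infinity>" using integrable_inverse_1_plus_square_lborel unfolding P_def
    by (simp add: integrable_iff_bounded)
  \<comment> \<open>The first majorant serves the near frequencies, with \<open>18 = 2 * 9\<close>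
    from the factor 2 between scales and the factor 9 in \<open>sq\<close>; the second serves the
    far ones, with \<open>9 ^ n\<close> the square of \<open>3 ^ n\<close>. Both have integrals over
    \<omega> that do not depend on \<xi>.\<close>
  have pointwise: "alpha_scale \<alpha> \<omega> * (cmod (fourier \<psi> (alpha_scale \<alpha> \<omega> * (\<xi> - \<omega>))))\<^sup>2 \<le>
      18 * C\<^sup>2 * (alpha_scale \<alpha> \<xi> * inverse (1 + (alpha_scale \<alpha> \<xi> * (\<xi> - \<omega>))\<^sup>2)) +
      9 ^ n * C\<^sup>2 * inverse (1 + \<omega>\<^sup>2)" for \<xi> \<omega>
  proof -
    define b where "b = alpha_scale \<alpha> \<xi>"
    define \<beta> where "\<beta> = alpha_scale \<alpha> \<omega>"
    define y where "y = \<beta> * (\<xi> - \<omega>)"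
    have pos: "0 < b" "0 < \<beta>" by (simp_all add: b_def \<beta>_def alpha_scale_pos)
    have "\<beta> \<le> 1" using powr_mono[of "- \<alpha>" 0 "1 + \<bar>\<omega>\<bar>"] \<alpha>
      by (simp add: \<beta>_def alpha_scale_def split: if_splits)
    show ?thesis
    proof (cases "\<bar>\<omega> - \<xi>\<bar> \<le> (1 + \<bar>\<xi>\<bar>) / 2")
      case True
      have "\<beta> \<le> b / (1 / 2)" "b \<le> \<beta> / (2 / 3)"
      proof -
        \<comment> \<open>In the near case \<open>1 + \<bar>\<omega>\<bar>\<close> lies between one
          half and three halves of \<open>1 + \<bar>\<xi>\<bar>\<close>.\<close>
        have "1 / 2 * (1 + \<bar>\<xi>\<bar>) \<le> 1 + \<bar>\<omega>\<bar>" "2 / 3 * (1 + \<bar>\<omega>\<bar>) \<le> 1 + \<bar>\<xi>\<bar>"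
          using True abs_triangle_ineq2[of \<xi> \<omega>] abs_triangle_ineq2[of \<omega> \<xi>]
          by (simp_all add: abs_minus_commute[of \<xi>] field_simps)
        then show "\<beta> \<le> b / (1 / 2)" "b \<le> \<beta> / (2 / 3)"
          unfolding b_def \<beta>_def using \<alpha> by (auto intro!: alpha_scale_le simp del: divide_divide_eq_right)
      qed
      then have \<beta>: "\<beta> \<le> 2 * b" "b \<le> 3 * \<beta>" using pos by simp_all
      have "(b * (\<xi> - \<omega>))\<^sup>2 \<le> (3 * (\<beta> * (\<xi> - \<omega>)))\<^sup>2"
        unfolding mult.assoc[symmetric] power_mult_distrib[of _ "\<xi> - \<omega>"]
        using \<beta> pos by (intro mult_right_mono power_mono) auto
      then have sq: "1 + (b * (\<xi> - \<omega>))\<^sup>2 \<le> 9 * (1 + \<bar>y\<bar>)\<^sup>2"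
        by (simp add: y_def power2_sum power_mult_distrib)
      have "(1 + \<bar>y\<bar>) * cmod (fourier \<psi> y) \<le> (1 + \<bar>y\<bar>) ^ n * cmod (fourier \<psi> y)"
        using power_increasing[OF n1, of "1 + \<bar>y\<bar>"] by (intro mult_right_mono) auto
      also have "\<dots> \<le> C" by (rule decay)
      finally have "((1 + \<bar>y\<bar>) * cmod (fourier \<psi> y))\<^sup>2 \<le> C\<^sup>2" by (intro power_mono) auto
      then have "(1 + (b * (\<xi> - \<omega>))\<^sup>2) * (cmod (fourier \<psi> y))\<^sup>2 \<le> 9 * C\<^sup>2"
        using mult_right_mono[OF sq, of "(cmod (fourier \<psi> y))\<^sup>2"] by (simp add: power_mult_distrib)
      then have "(cmod (fourier \<psi> y))\<^sup>2 \<le> 9 * C\<^sup>2 * inverse (1 + (b * (\<xi> - \<omega>))\<^sup>2)"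
        by (simp add: field_simps add_pos_nonneg)
      then have "\<beta> * (cmod (fourier \<psi> y))\<^sup>2 \<le> (2 * b) * (9 * C\<^sup>2 * inverse (1 + (b * (\<xi> - \<omega>))\<^sup>2))"
        using \<beta> pos by (intro mult_mono) auto
      moreover have "(2 * b) * (9 * C\<^sup>2 * inverse (1 + (b * (\<xi> - \<omega>))\<^sup>2)) =
          18 * C\<^sup>2 * (b * inverse (1 + (b * (\<xi> - \<omega>))\<^sup>2))" by simp
      moreover have "0 \<le> 9 ^ n * C\<^sup>2 * inverse (1 + \<omega>\<^sup>2)" by simp
      ultimately show ?thesis unfolding y_def b_def[symmetric] \<beta>_def[symmetric] by linarith
    next
      case False
      \<comment> \<open>\<open>1 + \<bar>\<omega>\<bar>\<close> is at most
        \<open>(1 + \<bar>\<xi>\<bar>) + \<bar>\<xi> - \<omega>\<bar>\<close>, and in the far case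
        the first summand is below \<open>2 * \<bar>\<xi> - \<omega>\<bar>\<close>.\<close>
      then have "1 + \<bar>\<omega>\<bar> \<le> 3 * \<bar>\<xi> - \<omega>\<bar>"
        using abs_triangle_ineq2[of \<omega> \<xi>] by (simp add: abs_minus_commute[of \<xi>])
      then have "\<beta> * (1 + \<bar>\<omega>\<bar>) \<le> \<beta> * (3 * \<bar>\<xi> - \<omega>\<bar>)" using pos by (intro mult_left_mono) auto
      then have "\<beta> * (1 + \<bar>\<omega>\<bar>) \<le> 3 * \<bar>y\<bar>" using pos by (simp add: y_def abs_mult)
      moreover have "\<beta> * (1 + \<bar>\<omega>\<bar>) = (1 + \<bar>\<omega>\<bar>) powr (1 - \<alpha>)"
        unfolding \<beta>_def alpha_scale_def using powr_add[of "1 + \<bar>\<omega>\<bar>" "- \<alpha>" 1] by simp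
      ultimately have "(1 + \<bar>\<omega>\<bar>) powr (1 - \<alpha>) \<le> 3 * (1 + \<bar>y\<bar>)" by simp
      then have "((1 + \<bar>\<omega>\<bar>) powr (1 - \<alpha>)) ^ n \<le> (3 * (1 + \<bar>y\<bar>)) ^ n" by (intro power_mono) auto
      \<comment> \<open>Here the choice of \<open>n\<close> enters:
        \<open>(1 - \<alpha>) * n\<close> is at least 1.\<close>
      moreover have "1 + \<bar>\<omega>\<bar> \<le> ((1 + \<bar>\<omega>\<bar>) powr (1 - \<alpha>)) ^ n"
      proof -
        have "(1 + \<bar>\<omega>\<bar>) powr 1 \<le> (1 + \<bar>\<omega>\<bar>) powr ((1 - \<alpha>) * real n)"
          using n by (intro powr_mono) (auto simp: mult.commute)
        then show ?thesis by (simp add: powr_powr[symmetric] powr_realpow)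
      qed
      ultimately have "1 + \<bar>\<omega>\<bar> \<le> 3 ^ n * (1 + \<bar>y\<bar>) ^ n"
        unfolding power_mult_distrib by linarith
      then have "(1 + \<bar>\<omega>\<bar>) * cmod (fourier \<psi> y) \<le> 3 ^ n * (1 + \<bar>y\<bar>) ^ n * cmod (fourier \<psi> y)"
        by (intro mult_right_mono) auto
      also have "\<dots> \<le> 3 ^ n * C" using decay[of y] by (simp add: mult.assoc)
      finally have "((1 + \<bar>\<omega>\<bar>) * cmod (fourier \<psi> y))\<^sup>2 \<le> (3 ^ n * C)\<^sup>2" by (intro power_mono) auto
      moreover have "1 + \<omega>\<^sup>2 \<le> (1 + \<bar>\<omega>\<bar>)\<^sup>2" by (simp add: power2_sum)
      then have "(1 + \<omega>\<^sup>2) * (cmod (fourier \<psi> y))\<^sup>2 \<le> ((1 + \<bar>\<omega>\<bar>) * cmod (fourier \<psi> y))\<^sup>2"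
        unfolding power_mult_distrib by (intro mult_right_mono) auto
      moreover have "(3 ^ n * C)\<^sup>2 = 9 ^ n * C\<^sup>2"
        by (simp add: power_mult_distrib power_mult[symmetric] mult.commute[of n]) (simp add: power_mult)
      ultimately have "(1 + \<omega>\<^sup>2) * (cmod (fourier \<psi> y))\<^sup>2 \<le> 9 ^ n * C\<^sup>2" by linarith
      then have "(cmod (fourier \<psi> y))\<^sup>2 \<le> 9 ^ n * C\<^sup>2 * inverse (1 + \<omega>\<^sup>2)"
        by (simp add: field_simps add_pos_nonneg)
      then have "\<beta> * (cmod (fourier \<psi> y))\<^sup>2 \<le> 1 * (9 ^ n * C\<^sup>2 * inverse (1 + \<omega>\<^sup>2))"
        using \<open>\<beta> \<le> 1\<close> pos by (intro mult_mono) auto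
      moreover have "0 \<le> 18 * C\<^sup>2 * (b * inverse (1 + (b * (\<xi> - \<omega>))\<^sup>2))" using pos by simp
      ultimately show ?thesis unfolding y_def b_def[symmetric] \<beta>_def[symmetric] by linarith
    qed
  qed
  have bound: "alpha_multiplier \<alpha> \<psi> \<xi> \<le> ennreal (18 * C\<^sup>2) * P + ennreal (9 ^ n * C\<^sup>2) * P" for \<xi>
  proof -
    define b where "b = alpha_scale \<alpha> \<xi>"
    have b: "0 < b" by (simp add: b_def alpha_scale_pos)
    \<comment> \<open>Substitution \<open>x = b * (\<xi> - \<omega>)\<close>; the factor
      \<open>b\<close> in the near majorant is exactly its Jacobian.\<close>
    have "P = ennreal b * (\<integral>\<^sup>+\<omega>. ennreal (inverse (1 + (b * (\<xi> - \<omega>))\<^sup>2)) \<partial>lborel)"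
      unfolding P_def
      using nn_integral_real_affine[of "\<lambda>x. ennreal (inverse (1 + x\<^sup>2))" "- b" "b * \<xi>"] b
      by (simp add: algebra_simps)
    also have "\<dots> = (\<integral>\<^sup>+\<omega>. ennreal (b * inverse (1 + (b * (\<xi> - \<omega>))\<^sup>2)) \<partial>lborel)"
      using b by (subst nn_integral_cmult[symmetric]) (auto simp: ennreal_mult)
    finally have P_eq: "P = (\<integral>\<^sup>+\<omega>. ennreal (b * inverse (1 + (b * (\<xi> - \<omega>))\<^sup>2)) \<partial>lborel)" .
    have "alpha_multiplier \<alpha> \<psi> \<xi> \<le>
        (\<integral>\<^sup>+\<omega>. ennreal (18 * C\<^sup>2) * ennreal (b * inverse (1 + (b * (\<xi> - \<omega>))\<^sup>2)) +
          ennreal (9 ^ n * C\<^sup>2) * ennreal (inverse (1 + \<omega>\<^sup>2)) \<partial>lborel)"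
      unfolding alpha_multiplier_def
    proof (rule nn_integral_mono)
      fix \<omega>
      show "ennreal (alpha_scale \<alpha> \<omega> * (cmod (fourier \<psi> (alpha_scale \<alpha> \<omega> * (\<xi> - \<omega>))))\<^sup>2) \<le>
          ennreal (18 * C\<^sup>2) * ennreal (b * inverse (1 + (b * (\<xi> - \<omega>))\<^sup>2)) +
          ennreal (9 ^ n * C\<^sup>2) * ennreal (inverse (1 + \<omega>\<^sup>2))"
        using ennreal_leI[OF pointwise[of \<omega> \<xi>]] b
        by (simp add: b_def[symmetric] ennreal_plus ennreal_mult[symmetric])
    qed
    also have "\<dots> = ennreal (18 * C\<^sup>2) * P + ennreal (9 ^ n * C\<^sup>2) * P"
      by (subst nn_integral_add) (auto simp: nn_integral_cmult P_eq[symmetric] P_def[symmetric])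
    finally show ?thesis .
  qed
  have "ennreal (18 * C\<^sup>2) * P + ennreal (9 ^ n * C\<^sup>2) * P < \<infinity>"
    using P by (simp add: ennreal_mult_less_top)
  then obtain B where "ennreal (18 * C\<^sup>2) * P + ennreal (9 ^ n * C\<^sup>2) * P = ennreal B"
    by (metis ennreal_cases infinity_ennreal_def less_irrefl)
  with bound show thesis by (intro that[of B]) simp
qed

text \<open>Asks for one order of decay only, so that it applies to Schwartz functions and to
  finitely smooth ones alike.\<close>

proposition alpha_admissible_if_fourier_decay:
  assumes \<alpha>: "0 \<le> \<alpha>" "\<alpha> < 1" and \<psi>: "cont_bdd_int \<psi>" and nz: "\<psi> \<noteq> (\<lambda>_. 0)"
    and n: "1 \<le> real n * (1 - \<alpha>)"
    and decay: "\<And>\<xi>. (1 + \<bar>\<xi>\<bar>) ^ n * cmod (fourier \<psi> \<xi>) \<le> C"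
  shows "alpha_admissible \<alpha> \<psi>"
proof -
  obtain A where A: "0 < A" "\<And>\<xi>. ennreal A \<le> alpha_multiplier \<alpha> \<psi> \<xi>"
    by (rule alpha_multiplier_lower[OF \<alpha> \<psi> nz]) (rule that)
  obtain B where B: "\<And>\<xi>. alpha_multiplier \<alpha> \<psi> \<xi> \<le> ennreal B"
    by (rule alpha_multiplier_upper[OF \<alpha> n decay]) (rule that)
  \<comment> \<open>The two bounds are obtained independently; \<open>max A B\<close> puts them in
    order.\<close>
  have "alpha_frame \<alpha> \<psi> A (max A B)"
  proof
    show "alpha_multiplier \<alpha> \<psi> \<xi> \<le> ennreal (max A B)" for \<xi>
      using B[of \<xi>] by (rule order_trans) (simp add: ennreal_leI)
  qed (use A \<psi> in auto)
  then show ?thesis by (rule alpha_frame.admissible)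
qed

section \<open>Fourier decay\<close>

text \<open>Integration by parts, done as the fundamental theorem of calculus for \<open>f\<close>
  times the character, whose boundary values at both infinities are 0.\<close>

lemma fourier_vector_derivative:
  assumes deriv: "\<And>x. (f has_vector_derivative f' x) (at x)"
    and cont: "continuous_on UNIV f'" and int: "integrable lborel f" "integrable lborel f'"
    and lim: "(f \<longlongrightarrow> 0) at_top" "(f \<longlongrightarrow> 0) at_bot"
  shows "fourier f' \<xi> = 2 * of_real pi * \<i> * of_real \<xi> * fourier f \<xi>"
proof -
  let ?e = "\<lambda>x. cis (- (2 * pi * \<xi> * x))" and ?c = "- (2 * of_real pi * \<i> * of_real \<xi>) :: complex"
  have e_exp: "?e x = exp (?c * of_real x)" for x
    by (simp add: cis_conv_exp mult_ac)
  have "((\<lambda>z. exp (?c * z)) has_field_derivative ?c * exp (?c * of_real x)) (at (of_real x))" for x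
    by (auto intro!: derivative_eq_intros)
  then have e_deriv: "(?e has_vector_derivative ?c * ?e x) (at x)" for x
    unfolding e_exp by (intro has_vector_derivative_real_field)
  have e_cont: "isCont ?e x" for x by (rule has_vector_derivative_continuous[OF e_deriv])
  have f_cont: "isCont f x" and f'_cont: "isCont f' x" for x
    using has_vector_derivative_continuous[OF deriv] cont by (auto simp: continuous_on_eq_continuous_at)
  have ints: "integrable lborel (\<lambda>x. f x * ?e x)" "integrable lborel (\<lambda>x. f' x * ?e x)"
    by (intro integrable_fourier int)+
  have norm_lim: "((\<lambda>x. f x * ?e x) \<longlongrightarrow> 0) F" if "(f \<longlongrightarrow> 0) F" for F
    using tendsto_norm_zero[OF that] by (subst tendsto_norm_zero_iff[symmetric]) (simp add: norm_mult)
  have "(LBINT x=-\<infinity>..\<infinity>. f x * (?c * ?e x) + f' x * ?e x) = 0 - 0"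
  proof (rule interval_integral_FTC_integrable)
    show "((\<lambda>x. f x * ?e x) has_vector_derivative (f x * (?c * ?e x) + f' x * ?e x)) (at x)" for x
      by (intro has_vector_derivative_mult deriv e_deriv)
    show "isCont (\<lambda>x. f x * (?c * ?e x) + f' x * ?e x) x" for x
      by (intro isCont_add isCont_mult continuous_const e_cont f_cont f'_cont)
    have "integrable lborel (\<lambda>x. ?c * (f x * ?e x) + f' x * ?e x)"
      by (intro Bochner_Integration.integrable_add integrable_mult_right ints)
    then show "set_integrable lborel (einterval (-\<infinity>) \<infinity>) (\<lambda>x. f x * (?c * ?e x) + f' x * ?e x)"
      by (simp add: set_integrable_def einterval_def mult_ac)
    show "(((\<lambda>x. f x * ?e x) \<circ> real_of_ereal) \<longlongrightarrow> 0) (at_right (-\<infinity>))"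
      "(((\<lambda>x. f x * ?e x) \<circ> real_of_ereal) \<longlongrightarrow> 0) (at_left \<infinity>)"
      unfolding ereal_tendsto_simps by (intro norm_lim lim)+
  qed simp
  then have "0 = (LINT x|lborel. ?c * (f x * ?e x) + f' x * ?e x)"
    by (simp add: interval_lebesgue_integral_def set_lebesgue_integral_def einterval_def mult_ac)
  also have "\<dots> = ?c * fourier f \<xi> + fourier f' \<xi>"
    unfolding fourier_def using ints
    by (subst Bochner_Integration.integral_add) auto
  finally have "?c * fourier f \<xi> + fourier f' \<xi> = 0" by (rule sym)
  then show ?thesis unfolding add_eq_0_iff by simp
qed

text \<open>Derivatives control only the homogeneous power, which says little near 0; there the
  uniform bound \<open>D\<close> takes over. The factor \<open>2 ^ n\<close> comes from
  \<open>1 + \<bar>\<xi>\<bar> \<le> 2 * max 1 \<bar>\<xi>\<bar>\<close>.\<close>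

lemma power_decay:
  assumes "\<bar>\<xi>\<bar> ^ n * cmod z \<le> C" "cmod z \<le> D"
  shows "(1 + \<bar>\<xi>\<bar>) ^ n * cmod z \<le> 2 ^ n * (C + D)"
proof -
  have "(1 + \<bar>\<xi>\<bar>) ^ n \<le> (2 * max 1 \<bar>\<xi>\<bar>) ^ n" by (intro power_mono) auto
  also have "\<dots> = 2 ^ n * max 1 \<bar>\<xi>\<bar> ^ n" by (rule power_mult_distrib)
  also have "\<dots> \<le> 2 ^ n * (\<bar>\<xi>\<bar> ^ n + 1)" by (intro mult_left_mono) (auto simp: max_def)
  finally have "(1 + \<bar>\<xi>\<bar>) ^ n * cmod z \<le> 2 ^ n * (\<bar>\<xi>\<bar> ^ n + 1) * cmod z" by (intro mult_right_mono) auto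
  also have "\<dots> = 2 ^ n * (\<bar>\<xi>\<bar> ^ n * cmod z + cmod z)" by (simp add: algebra_simps)
  also have "\<dots> \<le> 2 ^ n * (C + D)" using assms by (intro mult_left_mono add_mono) auto
  finally show ?thesis .
qed

section \<open>Fourier decay of Schwartz functions\<close>

context
  fixes \<psi> :: "real \<Rightarrow> complex"
  assumes schwartz: "schwartz \<psi>"
begin

abbreviation "D n \<equiv> iterated_derivative n \<psi>"

lemma schwartz_deriv: "(D n has_vector_derivative D (Suc n) x) (at x)"
  using schwartz by (simp add: schwartz_def vector_derivative_works[symmetric] iterated_derivative_def)

lemma schwartz_continuous: "continuous_on UNIV (D n)"
  using has_vector_derivative_continuous[OF schwartz_deriv]
  by (intro continuous_at_imp_continuous_on ballI)

lemma schwartz_bound: "\<exists>C\<ge>0. \<forall>x. cmod (D n x) \<le> C * inverse (1 + x\<^sup>2)"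
proof -
  have "bounded (range (\<lambda>x. of_real (x ^ k) * D n x))" for k
    using schwartz by (simp add: schwartz_def)
  \<comment> \<open>The seminorms with weights 1 and \<open>x^2\<close> add up to the weight
    \<open>1 + x^2\<close>.\<close>
  from this[of 0] this[of 2] obtain C0 C2 where
    C: "\<And>x. cmod (D n x) \<le> C0" "\<And>x. cmod (of_real (x\<^sup>2) * D n x) \<le> C2"
    unfolding bounded_iff by (auto simp del: of_real_power)
  have "cmod (D n x) \<le> (C0 + C2) * inverse (1 + x\<^sup>2)" for x
  proof -
    have "cmod (D n x) + x\<^sup>2 * cmod (D n x) \<le> C0 + C2"
      using C[of x] by (simp add: norm_mult del: of_real_power)
    then show ?thesis by (simp add: field_simps add_pos_nonneg)
  qed
  moreover have "0 \<le> C0 + C2" using order_trans[OF norm_ge_zero C(1)] order_trans[OF norm_ge_zero C(2)] by simp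
  ultimately show ?thesis by blast
qed

lemma schwartz_cont_bdd_int: "cont_bdd_int (D n)"
proof -
  obtain C where C: "0 \<le> C" "\<And>x. cmod (D n x) \<le> C * inverse (1 + x\<^sup>2)" using schwartz_bound by blast
  have "C * inverse (1 + x\<^sup>2) \<le> C" for x :: real
    using C(1) by (intro mult_left_le) (auto simp: inverse_le_1_iff)
  then have "cmod (D n x) \<le> C" for x using C(2) order_trans by blast
  moreover have "integrable lborel (D n)"
  proof (rule Bochner_Integration.integrable_bound)
    show "integrable lborel (\<lambda>x. C * inverse (1 + x\<^sup>2))"
      by (intro integrable_mult_right integrable_inverse_1_plus_square_lborel)
    show "D n \<in> borel_measurable lborel"
      using schwartz_continuous by (simp add: borel_measurable_continuous_onI)
    show "AE x in lborel. norm (D n x) \<le> norm (C * inverse (1 + x\<^sup>2))"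
      using C by (auto simp del: mult_nonneg_nonneg intro!: AE_I2 order_trans[OF C(2)])
  qed
  ultimately show ?thesis
    unfolding cont_bdd_int_def using schwartz_continuous by (auto intro: boundedI)
qed

lemma schwartz_tendsto:
  "(D n \<longlongrightarrow> 0) at_top" "(D n \<longlongrightarrow> 0) at_bot"
proof -
  obtain C where C: "0 \<le> C" "\<And>x. cmod (D n x) \<le> C * inverse (1 + x\<^sup>2)" using schwartz_bound by blast
  have "((\<lambda>x::real. C * inverse (1 + x\<^sup>2)) \<longlongrightarrow> 0) at_top" "((\<lambda>x::real. C * inverse (1 + x\<^sup>2)) \<longlongrightarrow> 0) at_bot"
    by real_asymp+
  note this[THEN Lim_null_comparison[OF always_eventually[OF allI[OF C(2)]]]]
  then show "(D n \<longlongrightarrow> 0) at_top" "(D n \<longlongrightarrow> 0) at_bot" .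
qed

lemma fourier_iterated_derivative: "fourier (D n) \<xi> = (2 * of_real pi * \<i> * of_real \<xi>) ^ n * fourier \<psi> \<xi>"
proof (induction n)
  case 0
  show ?case by (simp add: iterated_derivative_def)
next
  case (Suc n)
  have "fourier (D (Suc n)) \<xi> = 2 * of_real pi * \<i> * of_real \<xi> * fourier (D n) \<xi>"
    using schwartz_cont_bdd_int by (intro fourier_vector_derivative schwartz_deriv schwartz_continuous schwartz_tendsto)
      (auto simp: cont_bdd_int_def)
  with Suc show ?case by simp
qed

text \<open>The factor \<open>(2 * pi * \<bar>\<xi>\<bar>) ^ n\<close> is absorbed by the transform
  of the \<open>n\<close>-th derivative, which is bounded by its L1 norm.\<close>

lemma schwartz_fourier_decay: "\<exists>C. \<forall>\<xi>. (1 + \<bar>\<xi>\<bar>) ^ n * cmod (fourier \<psi> \<xi>) \<le> C"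
proof -
  have "\<bar>\<xi>\<bar> ^ n * cmod (fourier \<psi> \<xi>) \<le> (LINT t|lborel. cmod (D n t))" for \<xi>
  proof -
    have "\<bar>\<xi>\<bar> * 1 \<le> \<bar>\<xi>\<bar> * (2 * pi)" using pi_gt3 by (intro mult_left_mono) auto
    then have "\<bar>\<xi>\<bar> ^ n * cmod (fourier \<psi> \<xi>) \<le> (2 * pi * \<bar>\<xi>\<bar>) ^ n * cmod (fourier \<psi> \<xi>)"
      by (intro mult_right_mono power_mono) (auto simp: mult_ac)
    also have "\<dots> = cmod (fourier (D n) \<xi>)"
      by (simp add: fourier_iterated_derivative norm_mult norm_power)
    finally show ?thesis using fourier_bound[of "D n" \<xi>] by linarith
  qed
  from power_decay[OF this fourier_bound] show ?thesis by blast
qed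

end

text \<open>The compactly supported example is a power of \<open>max 0 (1 - t\<^sup>2)\<close>; the polynomial factor
  makes the class of functions considered closed under differentiation.\<close>

definition truncated_parabola :: "real poly \<Rightarrow> nat \<Rightarrow> real \<Rightarrow> complex" where
  "truncated_parabola q m t = of_real (poly q t * max 0 (1 - t\<^sup>2) ^ m)"

text \<open>The exponent is a successor because \<open>0 ^ 0 = 1\<close>: with exponent 0 there
  would be no truncation.\<close>

lemma truncated_parabola_eq_0: "1 \<le> \<bar>t\<bar> \<Longrightarrow> truncated_parabola q (Suc m) t = 0"
  using power_mono[of 1 "\<bar>t\<bar>" 2] by (simp add: truncated_parabola_def max_def)

lemma continuous_truncated_parabola: "continuous_on S (truncated_parabola q m)"
  unfolding truncated_parabola_def[abs_def] by (intro continuous_intros)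

lemma cont_bdd_int_truncated_parabola: "cont_bdd_int (truncated_parabola q (Suc m))"
proof -
  let ?g = "truncated_parabola q (Suc m)"
  have "range ?g \<subseteq> insert 0 (?g ` {-1..1})"
    using truncated_parabola_eq_0 by (force simp: image_iff abs_le_iff)
  moreover have "bounded (?g ` {-1..1})"
    by (intro compact_imp_bounded compact_continuous_image continuous_truncated_parabola) auto
  ultimately have "bounded (range ?g)" using bounded_subset by (metis bounded_insert)
  moreover have "integrable lborel ?g"
  proof -
    have "set_integrable lborel {-1..1} ?g"
      by (intro borel_integrable_atLeastAtMost' continuous_truncated_parabola)
    moreover have "indicator {-1..1} t *\<^sub>R ?g t = ?g t" for t
      using truncated_parabola_eq_0[of t q m] by (auto simp: indicator_def)
    ultimately show ?thesis by (simp add: set_integrable_def)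
  qed
  ultimately show ?thesis by (simp add: cont_bdd_int_def continuous_truncated_parabola)
qed

text \<open>The exponent is at least 2, so the corner of \<open>max 0 y\<close> at 0 disappears: the
  difference quotient there is \<open>max 0 h ^ Suc m\<close>, which tends to 0.\<close>

lemma DERIV_max_0_power:
  "((\<lambda>y::real. max 0 y ^ Suc (Suc m)) has_real_derivative real (m + 2) * max 0 y ^ Suc m) (at y)"
proof -
  consider "y < 0" | "y = 0" | "0 < y" by linarith
  then show ?thesis
  proof cases
    case 1
    have "((\<lambda>y::real. 0) has_real_derivative real (m + 2) * max 0 y ^ Suc m) (at y)" using 1 by simp
    then show ?thesis
      by (rule DERIV_cong_ev[THEN iffD1, rotated -1])
         (use 1 in \<open>auto intro!: eventually_nhds_in_open[of "{..<0}", THEN eventually_mono]\<close>)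
  next
    case 2
    have "((\<lambda>h::real. max 0 h ^ Suc m) \<longlongrightarrow> max 0 0 ^ Suc m) (at 0)" by (intro tendsto_intros)
    moreover have "max 0 h ^ Suc m = (max 0 (0 + h) ^ Suc (Suc m) - max 0 0 ^ Suc (Suc m)) / h" if "h \<noteq> 0" for h :: real
      using that by (simp add: max_def)
    ultimately have "((\<lambda>h::real. (max 0 (0 + h) ^ Suc (Suc m) - max 0 0 ^ Suc (Suc m)) / h) \<longlongrightarrow> max 0 0 ^ Suc m) (at 0)"
      by (subst (asm) LIM_equal) auto
    then show ?thesis using 2 by (simp add: DERIV_def)
  next
    case 3
    have "((\<lambda>y::real. y ^ Suc (Suc m)) has_real_derivative real (m + 2) * max 0 y ^ Suc m) (at y)"
      using DERIV_pow[of "Suc (Suc m)" y] 3 by (simp add: max_def)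
    then show ?thesis
      by (rule DERIV_cong_ev[THEN iffD1, rotated -1])
         (use 3 in \<open>auto intro!: eventually_nhds_in_open[of "{0<..}", THEN eventually_mono]\<close>)
  qed
qed

text \<open>The product rule yields the exponents \<open>m + 2\<close> and \<open>m + 1\<close>; one
  factor of the higher power is moved into the polynomial, which brings both terms to the same
  form.\<close>

lemma truncated_parabola_deriv:
  "(truncated_parabola q (Suc (Suc m)) has_vector_derivative
    truncated_parabola (pderiv q * [:1, 0, -1:] + smult (- 2 * real (m + 2)) (q * [:0, 1:])) (Suc m) t) (at t)"
proof -
  let ?s = "\<lambda>t::real. max 0 (1 - t\<^sup>2)"
  have "((\<lambda>t. ?s t ^ Suc (Suc m)) has_real_derivative (real (m + 2) * ?s t ^ Suc m) * (- 2 * t)) (at t)"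
    by (rule DERIV_chain2[OF DERIV_max_0_power]) (auto intro!: derivative_eq_intros)
  from DERIV_mult[OF poly_DERIV[of q t] this]
  have "((\<lambda>t. poly q t * ?s t ^ Suc (Suc m)) has_real_derivative
      poly (pderiv q * [:1, 0, -1:] + smult (- 2 * real (m + 2)) (q * [:0, 1:])) t * ?s t ^ Suc m) (at t)"
  proof (rule DERIV_cong)
    \<comment> \<open>Also valid where the truncation is active, since a positive power of
      \<open>?s t\<close> remains on both sides and vanishes there.\<close>
    have "?s t ^ Suc (Suc m) = (1 - t\<^sup>2) * ?s t ^ Suc m" by (simp add: max_def)
    then show "poly (pderiv q) t * ?s t ^ Suc (Suc m) + real (m + 2) * ?s t ^ Suc m * (- 2 * t) * poly q t =
        poly (pderiv q * [:1, 0, -1:] + smult (- 2 * real (m + 2)) (q * [:0, 1:])) t * ?s t ^ Suc m"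
      by (simp only:) (simp add: algebra_simps power2_eq_square)
  qed
  then show ?thesis
    unfolding truncated_parabola_def[abs_def]
    by (intro has_vector_derivative_of_real) (simp add: has_real_derivative_iff_has_vector_derivative)
qed

text \<open>Each differentiation gains a power of \<xi> and costs one exponent, so
  \<open>Suc m\<close> allows \<open>m\<close> of them and still ends with a continuous integrable
  function. The polynomial changes at each stage and is therefore generalised in the
  induction.\<close>

lemma truncated_parabola_fourier_decay:
  "\<exists>C. \<forall>\<xi>. \<bar>\<xi>\<bar> ^ m * cmod (fourier (truncated_parabola q (Suc m)) \<xi>) \<le> C"
proof (induction m arbitrary: q)
  case 0
  show ?case using fourier_bound by auto
next
  case (Suc m)
  define q' where "q' = pderiv q * [:1, 0, -1:] + smult (- 2 * real (m + 2)) (q * [:0, 1:])"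
  let ?g = "truncated_parabola q (Suc (Suc m))" and ?g' = "truncated_parabola q' (Suc m)"
  obtain C where C: "\<And>\<xi>. \<bar>\<xi>\<bar> ^ m * cmod (fourier ?g' \<xi>) \<le> C" using Suc by blast
  have "\<bar>\<xi>\<bar> ^ Suc m * cmod (fourier ?g \<xi>) \<le> C" for \<xi>
  proof -
    have "\<forall>\<^sub>F t in at_top. ?g t = 0"
      using eventually_ge_at_top[of 1] by eventually_elim (rule truncated_parabola_eq_0, linarith)
    moreover have "\<forall>\<^sub>F t in at_bot. ?g t = 0"
      using eventually_le_at_bot[of "-1"] by eventually_elim (rule truncated_parabola_eq_0, linarith)
    ultimately have lim: "(?g \<longlongrightarrow> 0) at_top" "(?g \<longlongrightarrow> 0) at_bot"
      by (auto intro: tendsto_eventually)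
    have "fourier ?g' \<xi> = 2 * of_real pi * \<i> * of_real \<xi> * fourier ?g \<xi>"
    proof (rule fourier_vector_derivative[OF _ _ _ _ lim])
      show "(?g has_vector_derivative ?g' t) (at t)" for t
        unfolding q'_def by (rule truncated_parabola_deriv)
    qed (use cont_bdd_int_truncated_parabola in \<open>auto simp: cont_bdd_int_def\<close>)
    then have "cmod (fourier ?g' \<xi>) = 2 * pi * (\<bar>\<xi>\<bar> * cmod (fourier ?g \<xi>))" by (simp add: norm_mult)
    moreover have "1 * (\<bar>\<xi>\<bar> * cmod (fourier ?g \<xi>)) \<le> 2 * pi * (\<bar>\<xi>\<bar> * cmod (fourier ?g \<xi>))"
      using pi_gt3 by (intro mult_right_mono) auto
    ultimately have "\<bar>\<xi>\<bar> * cmod (fourier ?g \<xi>) \<le> cmod (fourier ?g' \<xi>)" by simp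
    from mult_left_mono[OF this, of "\<bar>\<xi>\<bar> ^ m"] C[of \<xi>] show ?thesis by (simp add: mult_ac)
  qed
  then show ?case by blast
qed

theorem mainTheorem4:
  fixes \<alpha> :: real
  assumes "0 \<le> \<alpha>" and "\<alpha> < 1"
  shows "(\<forall>\<psi>. schwartz \<psi> \<and> \<psi> \<noteq> (\<lambda>_. 0) \<longrightarrow> alpha_admissible \<alpha> \<psi>) \<and>
         (\<exists>\<psi>. \<psi> \<in> L2 \<and> \<not> L2_eq \<psi> (\<lambda>_. 0) \<and> compact (closure {t. \<psi> t \<noteq> 0}) \<and>
              alpha_admissible \<alpha> \<psi>)"
proof -
  obtain n where n: "1 \<le> real n * (1 - \<alpha>)"
    using reals_Archimedean3[of "1 - \<alpha>"] assms(2) by (auto intro: less_imp_le)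
  have "alpha_admissible \<alpha> \<psi>" if \<psi>: "schwartz \<psi>" and nz: "\<psi> \<noteq> (\<lambda>_. 0)" for \<psi>
  proof -
    obtain C where C: "\<And>\<xi>. (1 + \<bar>\<xi>\<bar>) ^ n * cmod (fourier \<psi> \<xi>) \<le> C"
      using schwartz_fourier_decay[OF \<psi>] by blast
    have "cont_bdd_int \<psi>"
      using schwartz_cont_bdd_int[OF \<psi>, of 0] by (simp add: iterated_derivative_def)
    then show ?thesis
      by (rule alpha_admissible_if_fourier_decay[OF assms _ nz n C])
  qed
  moreover
  \<comment> \<open>The exponent \<open>Suc n\<close> provides decay of order \<open>n\<close>, the
    order that \<alpha> demands.\<close>
  define \<phi> where "\<phi> = truncated_parabola 1 (Suc n)"
  have \<phi>: "cont_bdd_int \<phi>" unfolding \<phi>_def by (rule cont_bdd_int_truncated_parabola)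
  have "\<phi> 0 = 1" by (simp add: \<phi>_def truncated_parabola_def)
  then have nz: "\<phi> \<noteq> (\<lambda>_. 0)" by auto
  obtain C where C: "\<And>\<xi>. \<bar>\<xi>\<bar> ^ n * cmod (fourier \<phi> \<xi>) \<le> C"
    using truncated_parabola_fourier_decay[of n 1] by (auto simp: \<phi>_def)
  have "alpha_admissible \<alpha> \<phi>"
    by (rule alpha_admissible_if_fourier_decay[OF assms \<phi> nz n power_decay[OF C fourier_bound]])
  moreover have "compact (closure {t. \<phi> t \<noteq> 0})"
  proof -
    have "t \<in> {-1..1}" if "\<phi> t \<noteq> 0" for t
      using truncated_parabola_eq_0[of t 1 n] that by (cases "1 \<le> \<bar>t\<bar>") (auto simp: \<phi>_def abs_less_iff not_le)
    then have "bounded {t. \<phi> t \<noteq> 0}" by (intro bounded_subset[OF bounded_closed_interval]) blast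
    then show ?thesis by (simp add: compact_closure)
  qed
  ultimately show ?thesis by (auto simp: alpha_admissible_def)
qed

end
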